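(* Let $L:[0,T]\times\mathbb{R}^N\times\mathbb{R}^N\to\mathbb{R}\cup\{\pm\infty\}$ satisfy (L1)–(L4), and let $U:[0,T]\times\mathbb{R}^N\to\mathbb{R}\cup\{\pm\infty\}$ be proper and lower semicontinuous and satisfy: for every $(t,x,u)\in\mathrm{epi}\,U\cap[0,T)\times\mathbb{R}^N\times\mathbb{R}$ and every $(n^t,n^x,n^u)\in N_{\mathrm{epi}\,U}(t,x,u)$ there exist sequences $(t_k,x_k)\to(t,x)$, $\alpha_k\to0$ and $v_k\in\mathrm{dom}\,L(t_k,x_k,\cdot)$ such that $n^t+\langle v_k,n^x\rangle-n^uL(t_k,x_k,v_k)\leq\alpha_k$ for all $k\in\mathbb{N}$. Then for every $(t_0,x_0,u_0)\in\mathrm{epi}\,U\cap[0,T)\times\mathbb{R}^N\times\mathbb{R}$ there exist $T_0\in(t_0,T)$ and an absolutely continuous $(x,u):[t_0,T_0]\to\mathbb{R}^N\times\mathbb{R}$ with $(x,u)(t_0)=(x_0,u_0)$, $(\dot x(t),\dot u(t))\in Q(t,x(t))$ for a.e. $t\in[t_0,T_0]$, and $u(t)\geq U(t,x(t))$ for all $t\in[t_0,T_0]$.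
   Context: $\mathbb{B}_R$ is the closed ball of radius $R$ at $0$. For a function $\varphi$, $\mathrm{dom}\,\varphi=\{z:\varphi(z)\neq\pm\infty\}$, $\mathrm{epi}\,\varphi=\{(z,r):\varphi(z)\leq r\}$; $\varphi$ is proper if it never equals $-\infty$ and is not identically $+\infty$. $U$ is regarded as $+\infty$ outside $[0,T]\times\mathbb{R}^N$. For $E\subset\mathbb{R}^M$, $w\in E$: tangent cone $T_E(w)=\{\zeta:\liminf_{\tau\to0^+}\mathrm{dist}(w+\tau\zeta,E)/\tau=0\}$, normal cone $N_E(w)=\{\xi:\langle\zeta,\xi\rangle\leq0\ \forall\zeta\in T_E(w)\}$. $Q(t,x):=\{(v,\eta)\in\mathbb{R}^N\times\mathbb{R}: L(t,x,v)\leq-\eta\}$. (L1) $L$ is lower semicontinuous in all variables. (L2) $L(t,x,\cdot)$ is convex and proper for every $t,x$. (L3) for every $(t,x,v)$ and every $(t_n,x_n)\to(t,x)$ there exist $v_n\to v$ with $L(t_n,x_n,v_n)\to L(t,x,v)$. (L4) for every $R\geq0$ there is $C_R\geq0$ with $L(t,x,v)=+\infty$ whenever $t\in[0,T]$, $x\in\mathbb{B}_R$, $|v|>C_R$. *)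

theory Defs
  imports "HOL-Analysis.Analysis"
begin

definition lsc_on :: "'a::topological_space set \<Rightarrow> ('a \<Rightarrow> ereal) \<Rightarrow> bool" where
  "lsc_on S f \<longleftrightarrow> (\<forall>z\<in>S. f z \<le> Liminf (at z within S) f)"

definition edom :: "('a \<Rightarrow> ereal) \<Rightarrow> 'a set" where
  "edom f = {z. f z \<noteq> \<infinity> \<and> f z \<noteq> -\<infinity>}"

definition epi :: "('a \<Rightarrow> ereal) \<Rightarrow> ('a \<times> real) set" where
  "epi f = {(z, r). f z \<le> ereal r}"

text \<open>Proper function (on a set S, the function being +infinity outside S).\<close>
definition proper_on :: "'a set \<Rightarrow> ('a \<Rightarrow> ereal) \<Rightarrow> bool" where
  "proper_on S f \<longleftrightarrow> (\<forall>z\<in>S. f z \<noteq> -\<infinity>) \<and> (\<exists>z\<in>S. f z \<noteq> \<infinity>)"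

definition econvex :: "('a::real_vector \<Rightarrow> ereal) \<Rightarrow> bool" where
  "econvex f \<longleftrightarrow> convex (epi f)"

definition tangent_cone :: "'a::real_normed_vector set \<Rightarrow> 'a \<Rightarrow> 'a set" where
  "tangent_cone E w =
     {\<zeta>. Liminf (at_right (0::real)) (\<lambda>\<tau>. ereal (infdist (w + \<tau> *\<^sub>R \<zeta>) E / \<tau>)) = 0}"

definition normal_cone :: "'a::real_inner set \<Rightarrow> 'a \<Rightarrow> 'a set" where
  "normal_cone E w = {\<xi>. \<forall>\<zeta>\<in>tangent_cone E w. inner \<zeta> \<xi> \<le> 0}"

definition Qset :: "(real \<Rightarrow> 'a \<Rightarrow> 'a \<Rightarrow> ereal) \<Rightarrow> real \<Rightarrow> 'a \<Rightarrow> ('a \<times> real) set" where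
  "Qset L t x = {(v, \<eta>). L t x v \<le> ereal (- \<eta>)}"

definition abs_cont_on :: "real \<Rightarrow> real \<Rightarrow> (real \<Rightarrow> 'b::real_normed_vector) \<Rightarrow> bool" where
  "abs_cont_on a b f \<longleftrightarrow>
     (\<forall>\<epsilon>>0. \<exists>\<delta>>0. \<forall>D :: (real \<times> real) set.
        finite D \<and> (\<forall>(c, d)\<in>D. a \<le> c \<and> c \<le> d \<and> d \<le> b) \<and>
        (\<forall>p\<in>D. \<forall>q\<in>D. p \<noteq> q \<longrightarrow> {fst p<..<snd p} \<inter> {fst q<..<snd q} = {}) \<and>
        (\<Sum>(c, d)\<in>D. d - c) < \<delta>
        \<longrightarrow> (\<Sum>(c, d)\<in>D. norm (f d - f c)) < \<epsilon>)"

end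

theory Submission
  imports Defs "HOL-Complex_Analysis.Great_Picard"
begin

text \<open>
  Since \<open>L\<close> may be unbounded above on its effective domain, the admissible velocities \<open>(1, v, -l)\<close> with
  \<open>l = L t x v\<close> are unbounded and the component \<open>u\<close> of a solution need not be Lipschitz. Dividing them by
  \<open>1 + \<bar>l\<bar>\<close> amounts to a change of time after which they are bounded. Euler polygons whose velocity at \<open>z\<close>
  is admissible near a closest point \<open>s\<close> of the epigraph \<open>K\<close> of \<open>U\<close> and has an almost nonpositive
  inner product with the normal \<open>z - s\<close> (proximal aiming) stay close to \<open>K\<close>, and by Arzela-Ascoli they converge to a curve \<open>(t, x, u)\<close> in \<open>K\<close>.
  Every affine minorant of \<open>L\<close> near a point yields a linear inequality for the increments of this curve.

  Starting at \<open>u = U t0 x0\<close>, the curve cannot keep \<open>t\<close> constant, as \<open>u\<close> would then drop below \<open>U\<close>.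
  So it can be parametrised by \<open>t\<close> again: \<open>x\<close> becomes a Lipschitz function \<open>X\<close>, while \<open>u\<close> becomes
  a function \<open>W\<close> with \<open>G t = M * t - W t\<close> increasing, possibly with jumps. Replacing \<open>G\<close> by the
  integral of the lower limit of its backward difference quotients only increases the second component
  (Fatou) and makes it absolutely continuous, and convex duality turns the linear inequalities
  into the differential inclusion.
\<close>

subsection \<open>Differentiation of indefinite integrals and of Lipschitz functions\<close>

text \<open>This puts the first-order error of the indefinite integral into the form of a term of
  Henstock's lemma for the interval between \<open>x\<close> and \<open>y\<close> with tag
  \<open>x\<close>, on whichever side of \<open>x\<close> the point \<open>y\<close> lies.\<close>

lemma segment_integral_norm_eq:
  fixes f :: "real \<Rightarrow> 'b::euclidean_space"
  assumes f: "f integrable_on {a..b}" and x: "x \<in> {a..b}" and y: "y \<in> {a..b}"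
  shows "norm (integral {a..y} f - integral {a..x} f - (y - x) *\<^sub>R f x)
    = norm (measure lborel {min x y..max x y} *\<^sub>R f x - integral {min x y..max x y} f)"
proof (cases "x \<le> y")
  case True
  have "integral {a..x} f + integral {x..y} f = integral {a..y} f"
    by (rule Henstock_Kurzweil_Integration.integral_combine)
       (use x y True in \<open>auto intro: integrable_on_subinterval[OF f]\<close>)
  then have "integral {a..y} f - integral {a..x} f = integral {x..y} f"
    by (simp add: algebra_simps)
  with True show ?thesis by (simp add: norm_minus_commute)
next
  case False
  have "integral {a..y} f + integral {y..x} f = integral {a..x} f"
    by (rule Henstock_Kurzweil_Integration.integral_combine)
       (use x y False in \<open>auto intro: integrable_on_subinterval[OF f]\<close>)
  then have *: "integral {a..x} f = integral {a..y} f + integral {y..x} f"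
    by simp
  from False show ?thesis unfolding * by (simp add: algebra_simps)
qed

text \<open>Vitali's theorem selects disjoint intervals with large difference quotients, and Henstock's lemma bounds
  their total length.\<close>

lemma negligible_large_difference_quotient:
  fixes f :: "real \<Rightarrow> 'b::euclidean_space"
  assumes f: "f integrable_on {a..b}" and e: "0 < e"
  shows "negligible {x \<in> {a..b}. \<forall>d>0. \<exists>y\<in>{a..b}. y \<noteq> x \<and> \<bar>y - x\<bar> < d \<and>
           e * \<bar>y - x\<bar> < norm (integral {a..y} f - integral {a..x} f - (y - x) *\<^sub>R f x)}"
    (is "negligible ?S")
  unfolding negligible_outer_le
proof (intro allI impI)
  fix \<eta> :: real
  assume "0 < \<eta>"
  with e have "0 < e * \<eta>" by simp
  with f obtain \<gamma> where \<gamma>: "gauge \<gamma>"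
    and hen: "\<And>p. \<lbrakk>p tagged_partial_division_of (cbox a b); \<gamma> fine p\<rbrakk> \<Longrightarrow>
             sum (\<lambda>(x,k). norm(measure lborel k *\<^sub>R f x - integral k f)) p < e * \<eta>"
    using Henstock_lemma[of f a b "e * \<eta>"] by (auto simp: cbox_interval)
  define seg where "seg = (\<lambda>(x::real, y). {min x y..max x y})"
  have seg_cball: "seg i = cball ((fst i + snd i) / 2) (\<bar>snd i - fst i\<bar> / 2)" for i
    by (cases i) (auto simp: seg_def cball_eq_atLeastAtMost min_def max_def field_simps)
  \<comment> \<open>A pair \<open>(x, y)\<close> encodes a tagged interval with the tag
    \<open>x\<close> at one end. Every point of \<open>?S\<close> is the tag of arbitrarily short
    members of \<open>K\<close>, so these form a Vitali covering.\<close>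
  define K where "K = {(x, y). x \<in> {a..b} \<and> y \<in> {a..b} \<and> y \<noteq> x \<and> seg (x, y) \<subseteq> \<gamma> x \<and>
           e * \<bar>y - x\<bar> < norm (integral {a..y} f - integral {a..x} f - (y - x) *\<^sub>R f x)}"
  have K_pos: "0 < \<bar>snd i - fst i\<bar> / 2" if "i \<in> K" for i
    using that by (auto simp: K_def)
  have "\<exists>i. i \<in> K \<and> x \<in> cball ((fst i + snd i) / 2) (\<bar>snd i - fst i\<bar> / 2) \<and> \<bar>snd i - fst i\<bar> / 2 < d"
    if x: "x \<in> ?S" and d: "0 < d" for x d
  proof -
    from \<gamma> obtain r where r: "0 < r" "ball x r \<subseteq> \<gamma> x"
      unfolding gauge_def by (meson openE)
    then have "0 < min r d" using d by simp
    with x obtain y where y: "y \<in> {a..b}" "y \<noteq> x" "\<bar>y - x\<bar> < min r d"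
      "e * \<bar>y - x\<bar> < norm (integral {a..y} f - integral {a..x} f - (y - x) *\<^sub>R f x)"
      unfolding mem_Collect_eq by blast
    have "seg (x, y) \<subseteq> ball x r"
      using y by (auto simp: seg_def dist_real_def)
    with r y x have "(x, y) \<in> K" by (auto simp: K_def)
    moreover have "x \<in> seg (x, y)" by (auto simp: seg_def)
    ultimately show ?thesis
      using y d unfolding seg_cball by (intro exI[of _ "(x, y)"]) auto
  qed
  then obtain C where C: "countable C" "C \<subseteq> K"
     "pairwise (\<lambda>i j. disjnt (seg i) (seg j)) C" "negligible (?S - (\<Union>i\<in>C. seg i))"
    using Vitali_covering_theorem_cballs[of K "\<lambda>i. \<bar>snd i - fst i\<bar> / 2" ?S "\<lambda>i. (fst i + snd i) / 2"]
      K_pos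
    unfolding seg_cball[symmetric] by blast
  \<comment> \<open>A finite disjoint subfamily is a partial tagged division. Each interval has an
    error above \<open>e\<close> times its length, while Henstock's lemma keeps the total error
    below \<open>e * \<eta>\<close>.\<close>
  have bound: "measure lebesgue (\<Union>i\<in>C'. seg i) \<le> \<eta>" if C': "C' \<subseteq> C" "finite C'" for C'
  proof -
    define g where "g = (\<lambda>i. (fst i, seg i))"
    have inj: "inj_on g C'"
      unfolding inj_on_def g_def seg_def by (auto simp: min_def max_def split: if_splits)
    have "g ` C' tagged_partial_division_of cbox a b"
      unfolding tagged_partial_division_of_def
    proof (intro conjI allI impI)
      show "finite (g ` C')" using C' by simp
    next
      fix x k assume "(x, k) \<in> g ` C'"
      then obtain y where "(x, y) \<in> C'" "k = seg (x, y)" by (auto simp: g_def)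
      with C' C(2) show "x \<in> k" "k \<subseteq> cbox a b" "\<exists>a b. k = cbox a b"
        by (auto simp: seg_def K_def cbox_interval)
    next
      fix x1 k1 x2 k2
      assume *: "(x1, k1) \<in> g ` C' \<and> (x2, k2) \<in> g ` C' \<and> (x1, k1) \<noteq> (x2, k2)"
      then obtain i j where "i \<in> C'" "j \<in> C'" "i \<noteq> j" "k1 = seg i" "k2 = seg j"
        by (auto simp: g_def)
      with C(3) C'(1) have "disjnt k1 k2" by (auto simp: pairwise_def)
      then show "interior k1 \<inter> interior k2 = {}"
        unfolding disjnt_def using interior_subset[of k1] interior_subset[of k2] by blast
    qed
    moreover have "\<gamma> fine g ` C'"
      using C' C(2) unfolding fine_def g_def K_def by fastforce
    ultimately have "sum (\<lambda>(x,k). norm(measure lborel k *\<^sub>R f x - integral k f)) (g ` C') < e * \<eta>"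
      by (rule hen)
    then have lt: "(\<Sum>i\<in>C'. norm (measure lborel (seg i) *\<^sub>R f (fst i) - integral (seg i) f)) < e * \<eta>"
      by (simp add: sum.reindex[OF inj]) (simp add: g_def)
    have "e * (\<Sum>i\<in>C'. \<bar>snd i - fst i\<bar>) \<le> (\<Sum>i\<in>C'. norm (measure lborel (seg i) *\<^sub>R f (fst i) - integral (seg i) f))"
      unfolding sum_distrib_left
    proof (rule sum_mono)
      fix i assume "i \<in> C'"
      with C' C have "i \<in> K" by auto
      then show "e * \<bar>snd i - fst i\<bar> \<le> norm (measure lborel (seg i) *\<^sub>R f (fst i) - integral (seg i) f)"
        using segment_integral_norm_eq[OF f, of "fst i" "snd i"]
        by (auto simp: K_def seg_def)
    qed
    with lt have "e * (\<Sum>i\<in>C'. \<bar>snd i - fst i\<bar>) < e * \<eta>" by linarith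
    with e have "(\<Sum>i\<in>C'. \<bar>snd i - fst i\<bar>) \<le> \<eta>" by simp
    moreover have "measure lebesgue (\<Union>i\<in>C'. seg i) \<le> (\<Sum>i\<in>C'. measure lebesgue (seg i))"
      by (rule measure_UNION_le) (use C' in \<open>auto simp: seg_def\<close>)
    moreover have "measure lebesgue (seg i) = \<bar>snd i - fst i\<bar>" for i
      by (auto simp: seg_def split: prod.split)
    ultimately show ?thesis by simp
  qed
  have meas: "seg i \<in> lmeasurable" for i
    by (simp add: seg_cball)
  note U = fmeasurable_UN_bound[of C seg lebesgue \<eta>] measure_UN_bound[of C seg lebesgue \<eta>]
  let ?T = "(\<Union>i\<in>C. seg i) \<union> (?S - (\<Union>i\<in>C. seg i))"
  have "(\<Union>i\<in>C. seg i) \<in> lmeasurable" "measure lebesgue (\<Union>i\<in>C. seg i) \<le> \<eta>"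
    using U meas bound C(1) by auto
  moreover have "measure lebesgue ?T \<le> measure lebesgue (\<Union>i\<in>C. seg i) + measure lebesgue (?S - (\<Union>i\<in>C. seg i))"
    by (rule measure_Un_le) (use calculation C(4) in \<open>auto intro: negligible_imp_sets\<close>)
  moreover have "?T \<in> lmeasurable"
    using calculation C(4) by (intro fmeasurable.Un) (auto intro: negligible_imp_measurable)
  ultimately show "\<exists>T. ?S \<subseteq> T \<and> T \<in> lmeasurable \<and> measure lebesgue T \<le> \<eta>"
    using C(4) by (intro exI[of _ ?T]) (auto simp: negligible_imp_measure0)
qed

text \<open>Where the derivative fails to be \<open>f x\<close>, the relative error exceeds some
  \<open>1 / Suc n\<close> at points arbitrarily near \<open>x\<close>. The exceptional set is thus
  covered by countably many of the negligible sets from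
  \<open>negligible_large_difference_quotient\<close>.\<close>

theorem indefinite_integral_has_vector_derivative_AE:
  fixes f :: "real \<Rightarrow> 'b::euclidean_space"
  assumes f: "f integrable_on {a..b}"
  shows "negligible {x \<in> {a..b}. \<not> ((\<lambda>y. integral {a..y} f) has_vector_derivative f x) (at x within {a..b})}"
    (is "negligible ?N")
proof -
  let ?S = "\<lambda>e. {x \<in> {a..b}. \<forall>d>0. \<exists>y\<in>{a..b}. y \<noteq> x \<and> \<bar>y - x\<bar> < d \<and>
           e * \<bar>y - x\<bar> < norm (integral {a..y} f - integral {a..x} f - (y - x) *\<^sub>R f x)}"
  have "?N \<subseteq> (\<Union>n. ?S (1 / real (Suc n)))"
  proof
    fix x assume x: "x \<in> ?N"
    then obtain e where e: "0 < e" and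
      *: "\<not> (\<exists>d>0. \<forall>y\<in>{a..b}. norm (y - x) < d \<longrightarrow>
          norm (integral {a..y} f - integral {a..x} f - (y - x) *\<^sub>R f x) \<le> e * norm (y - x))"
      unfolding has_vector_derivative_def has_derivative_within_alt
      by (auto simp: bounded_linear_scaleR_left)
    obtain n where n: "1 / real (Suc n) < e"
      using e nat_approx_posE by blast
    have "x \<in> ?S (1 / real (Suc n))"
    proof (clarsimp, intro conjI allI impI)
      show "a \<le> x" "x \<le> b" using x by auto
      fix d :: real assume "0 < d"
      with * obtain y where y: "y \<in> {a..b}" "\<bar>y - x\<bar> < d"
        "e * \<bar>y - x\<bar> < norm (integral {a..y} f - integral {a..x} f - (y - x) *\<^sub>R f x)"
        unfolding real_norm_def by (meson not_le)
      then have "y \<noteq> x" by auto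
      then have "\<bar>y - x\<bar> / (1 + real n) \<le> e * \<bar>y - x\<bar>"
        using n mult_right_mono[of "1 / real (Suc n)" e "\<bar>y - x\<bar>"] by simp
      then show "\<exists>y\<in>{a..b}. y \<noteq> x \<and> \<bar>y - x\<bar> < d \<and>
         \<bar>y - x\<bar> / (1 + real n) < norm (integral {a..y} f - integral {a..x} f - (y - x) *\<^sub>R f x)"
        using y \<open>y \<noteq> x\<close> by (intro bexI[of _ y]) auto
    qed
    then show "x \<in> (\<Union>n. ?S (1 / real (Suc n)))" by blast
  qed
  moreover have "negligible (\<Union>n. ?S (1 / real (Suc n)))"
  proof (rule negligible_countable_Union)
    fix N assume "N \<in> range (\<lambda>n. ?S (1 / real (Suc n)))"
    then obtain n where "N = ?S (1 / real (Suc n))" by blast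
    then show "negligible N"
      using negligible_large_difference_quotient[OF f, of "1 / real (Suc n)"] by simp
  qed simp
  ultimately show ?thesis
    using negligible_subset by blast
qed

text \<open>The Stieltjes measures of \<open>g\<close> and of \<open>x - g x\<close> add up to Lebesgue measure, so the first one has
  a density.\<close>

lemma mono_nonexpansive_has_density:
  fixes g :: "real \<Rightarrow> real"
  assumes g: "\<And>x y. x \<le> y \<Longrightarrow> 0 \<le> g y - g x \<and> g y - g x \<le> y - x"
  obtains f where "\<And>a b. a \<le> b \<Longrightarrow> (f has_integral (g b - g a)) {a..b}"
proof -
  have g_mono: "g x \<le> g y" and g_mono': "x - g x \<le> y - g y" if "x \<le> y" for x y
    using g[OF that] by auto
  have lip: "1-lipschitz_on UNIV g"
  proof (rule lipschitz_onI)
    show "dist (g x) (g y) \<le> 1 * dist x y" for x y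
      using g[of x y] g[of y x] by (cases "x \<le> y") (auto simp: dist_real_def)
  qed simp
  then have cont: "continuous_on UNIV g" by (rule lipschitz_on_continuous_on)
  then have cont': "continuous_on UNIV (\<lambda>x. x - g x)" by (intro continuous_intros)
  have right: "continuous (at_right a) g" "continuous (at_right a) (\<lambda>x. x - g x)" for a
    using cont cont' by (meson continuous_on_eq_continuous_at continuous_at_imp_continuous_within open_UNIV UNIV_I)+
  define \<mu> where "\<mu> = interval_measure g"
  define \<nu> where "\<nu> = interval_measure (\<lambda>x. x - g x)"
  have sets[simp]: "sets \<mu> = sets borel" "sets \<nu> = sets borel"
    by (simp_all add: \<mu>_def \<nu>_def)
  define M where "M = measure_of UNIV (sets borel) (\<lambda>A. emeasure \<mu> A + emeasure \<nu> A)"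
  have sets_M: "sets M = sets borel"
    by (simp add: M_def sets.sigma_sets_eq[of borel, simplified])
  have M: "emeasure M A = emeasure \<mu> A + emeasure \<nu> A" if "A \<in> sets borel" for A
    unfolding M_def
  proof (rule emeasure_measure_of_sigma)
    show "sigma_algebra UNIV (sets (borel :: real measure))"
      using sets.sigma_algebra_axioms[of "borel :: real measure"] by simp
    show "positive (sets borel) (\<lambda>A. emeasure \<mu> A + emeasure \<nu> A)"
      by (simp add: positive_def)
    show "countably_additive (sets borel) (\<lambda>A. emeasure \<mu> A + emeasure \<nu> A)"
      unfolding countably_additive_def
    proof (intro allI impI)
      fix A :: "nat \<Rightarrow> real set"
      assume A: "range A \<subseteq> sets borel" "disjoint_family A"
      have "(\<Sum>i. emeasure \<mu> (A i) + emeasure \<nu> (A i)) = (\<Sum>i. emeasure \<mu> (A i)) + (\<Sum>i. emeasure \<nu> (A i))"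
        by (rule suminf_add[symmetric]) auto
      also have "\<dots> = emeasure \<mu> (\<Union> (range A)) + emeasure \<nu> (\<Union> (range A))"
        using A by (simp add: suminf_emeasure)
      finally show "(\<Sum>i. emeasure \<mu> (A i) + emeasure \<nu> (A i)) = emeasure \<mu> (\<Union> (range A)) + emeasure \<nu> (\<Union> (range A))" .
    qed
  qed (fact that)
  \<comment> \<open>It suffices to compare half-open intervals, where the masses
    \<open>g b - g a\<close> and \<open>(b - g b) - (a - g a)\<close> add up to
    \<open>b - a\<close>.\<close>
  have "interval_measure (\<lambda>x. x) = M"
  proof (rule measure_eqI_generator_eq[where E="range (\<lambda>(a, b). {a<..b::real})" and \<Omega>=UNIV and A="\<lambda>i. {- real i<..real i}"])
    show "Int_stable (range (\<lambda>(a, b). {a<..b::real}))"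
      by (auto simp: Int_stable_def)
    fix X assume "X \<in> range (\<lambda>(a, b). {a<..b::real})"
    then obtain a b where X: "X = {a<..b}" by auto
    show "emeasure (interval_measure (\<lambda>x. x)) X = emeasure M X"
      using g[of a b] unfolding X M[OF greaterThanAtMost_borel] \<mu>_def \<nu>_def
      by (subst (1 2 3) emeasure_interval_measure_Ioc_eq)
         (auto simp: g_mono g_mono' right ennreal_plus[symmetric] simp del: ennreal_plus)
  next
    show "(\<Union>i. {- real i<..real i}) = UNIV"
    proof -
      have "\<exists>i. x \<in> {- real i<..real i}" for x
      proof -
        obtain n where "\<bar>x\<bar> < real n" using reals_Archimedean2 by blast
        then show ?thesis by (intro exI[of _ n]) auto
      qed
      then show ?thesis by blast
    qed
    show "emeasure (interval_measure (\<lambda>x. x)) {- real i<..real i} \<noteq> \<infinity>" for i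
      by (simp add: emeasure_interval_measure_Ioc_eq)
  qed (auto simp: sets_M borel_sigma_sets_Ioc)
  then have lborel_M: "lborel = M" by (simp add: lborel_eq_real)
  have "absolutely_continuous lborel \<mu>"
    unfolding absolutely_continuous_def
  proof
    fix A :: "real set" assume A: "A \<in> null_sets lborel"
    then have "A \<in> sets borel" "emeasure M A = 0" by (auto simp: null_sets_def lborel_M[symmetric])
    then show "A \<in> null_sets \<mu>" using M[of A] by (auto simp: null_sets_def)
  qed
  then obtain d where d: "d \<in> borel_measurable lborel" "density lborel d = \<mu>"
    using sigma_finite_measure.Radon_Nikodym[OF sigma_finite_lborel, of \<mu>] by auto
  \<comment> \<open>The Radon-Nikodym density may be infinite, and \<open>enn2real\<close> replaces
    infinity by 0. The mass of \<open>{a..b}\<close> is finite, so this happens only on a null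
    subset of it.\<close>
  have int: "((\<lambda>x. enn2real (d x)) has_integral (g b - g a)) {a..b}" if ab: "a \<le> b" for a b
  proof -
    have "emeasure \<mu> {a..b} = ennreal (g b - g a)"
      unfolding \<mu>_def using ab g_mono cont by (rule emeasure_interval_measure_Icc)
    then have nn: "(\<integral>\<^sup>+x. d x * indicator {a..b} x \<partial>lborel) = ennreal (g b - g a)"
      unfolding d(2)[symmetric] using d(1) by (subst (asm) emeasure_density) auto
    then have "AE x in lborel. d x * indicator {a..b} x \<noteq> \<infinity>"
      using d(1) by (intro nn_integral_noteq_infinite) auto
    then have "AE x in lborel. ennreal (enn2real (d x) * indicator {a..b} x) = d x * indicator {a..b} x"
      by eventually_elim (auto simp: indicator_def less_top)
    then have "(\<integral>\<^sup>+x. ennreal (enn2real (d x) * indicator {a..b} x) \<partial>lborel) = ennreal (g b - g a)"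
      unfolding nn[symmetric] by (rule nn_integral_cong_AE)
    then have "((\<lambda>x. enn2real (d x) * indicator {a..b} x) has_integral (g b - g a)) UNIV"
      using d(1) g[OF ab] by (intro nn_integral_has_integral) auto
    moreover have "(\<lambda>x. enn2real (d x) * indicator {a..b} x) = (\<lambda>x. if x \<in> {a..b} then enn2real (d x) else 0)"
      by (auto simp: indicator_def)
    ultimately show ?thesis
      by (simp only: has_integral_restrict_UNIV)
  qed
  then show thesis by (rule that)
qed

text \<open>The slopes of \<open>f\<close> lie in \<open>[-C, C]\<close>. Dividing by
  \<open>D\<close> and adding \<open>x / 2\<close> moves them into \<open>[0, 1]\<close>, so the
  rescaled function is an indefinite integral and differentiable almost everywhere; undoing the
  rescaling returns to \<open>f\<close>.\<close>

lemma lipschitz_real_differentiable_AE: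
  fixes f :: "real \<Rightarrow> real"
  assumes lip: "C-lipschitz_on {a..b} f"
  shows "negligible {x \<in> {a..b}. \<not> f differentiable (at x within {a..b})}"
proof (cases "a \<le> b")
  case True
  \<comment> \<open>The factor 2 confines the slopes of \<open>f / D\<close> to
    \<open>[-1/2, 1/2]\<close>; the summand 1 keeps \<open>D\<close> positive when
    \<open>C = 0\<close>.\<close>
  define D where "D = 2 * (C + 1)"
  have C: "0 \<le> C" using lip by (rule lipschitz_on_nonneg)
  then have D: "0 < D" by (simp add: D_def)
  define clamp where "clamp x = max a (min b x)" for x
  have clamp: "clamp x \<in> {a..b}" for x using True by (auto simp: clamp_def)
  have clamp_le: "0 \<le> clamp y - clamp x \<and> clamp y - clamp x \<le> y - x" if "x \<le> y" for x y
    using True that by (auto simp: clamp_def)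
  define g where "g x = f (clamp x) / D + x / 2" for x
  have "0 \<le> g y - g x \<and> g y - g x \<le> y - x" if xy: "x \<le> y" for x y
  proof -
    have "\<bar>f (clamp y) - f (clamp x)\<bar> \<le> C * \<bar>clamp y - clamp x\<bar>"
      using lipschitz_onD[OF lip clamp clamp, of y x] by (simp add: dist_real_def)
    also have "\<dots> \<le> (C + 1) * (y - x)"
      using clamp_le[OF xy] C by (intro mult_mono) auto
    finally have "\<bar>f (clamp y) - f (clamp x)\<bar> / D \<le> (y - x) / 2"
      using C by (simp add: D_def field_simps)
    then have "\<bar>(f (clamp y) - f (clamp x)) / D\<bar> \<le> (y - x) / 2"
      using D by simp
    moreover have "g y - g x = (f (clamp y) - f (clamp x)) / D + (y - x) / 2"
      by (simp add: g_def diff_divide_distrib)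
    ultimately show ?thesis unfolding abs_le_iff by argo
  qed
  then obtain h where h: "\<And>a b. a \<le> b \<Longrightarrow> (h has_integral (g b - g a)) {a..b}"
    using mono_nonexpansive_has_density by metis
  have "f differentiable (at x within {a..b})"
    if x: "x \<in> {a..b}" and d: "((\<lambda>y. integral {a..y} h) has_vector_derivative h x) (at x within {a..b})" for x
  proof -
    have eq: "f y = D * (integral {a..y} h + g a - y / 2)" if "y \<in> {a..b}" for y
    proof -
      have "integral {a..y} h = g y - g a"
        using h[of a y] that by (simp add: integral_unique)
      moreover have "clamp y = y" using that by (simp add: clamp_def)
      ultimately show ?thesis using D by (simp add: g_def)
    qed
    have "((\<lambda>y. D * (integral {a..y} h + g a - y / 2)) has_real_derivative D * (h x - 1 / 2)) (at x within {a..b})"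
      using d by (auto intro!: derivative_eq_intros simp: has_real_derivative_iff_has_vector_derivative[symmetric])
    then have "(f has_real_derivative D * (h x - 1 / 2)) (at x within {a..b})"
      by (rule has_field_derivative_transform_within[OF _ zero_less_one x]) (use eq in auto)
    then show ?thesis
      by (meson has_field_derivative_imp_has_derivative differentiable_def)
  qed
  then have "{x \<in> {a..b}. \<not> f differentiable (at x within {a..b})}
    \<subseteq> {x \<in> {a..b}. \<not> ((\<lambda>y. integral {a..y} h) has_vector_derivative h x) (at x within {a..b})}"
    by blast
  moreover have "h integrable_on {a..b}" using h[OF True] by blast
  ultimately show ?thesis
    using indefinite_integral_has_vector_derivative_AE negligible_subset by blast
qed auto

lemma lipschitz_differentiable_AE:
  fixes f :: "real \<Rightarrow> 'b::euclidean_space"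
  assumes lip: "C-lipschitz_on {a..b} f"
  shows "negligible {x \<in> {a..b}. \<not> f differentiable (at x within {a..b})}"
proof -
  have "C-lipschitz_on {a..b} (\<lambda>x. f x \<bullet> i)" if "i \<in> Basis" for i
  proof (rule lipschitz_onI)
    show "dist (f x \<bullet> i) (f y \<bullet> i) \<le> C * dist x y" if xy: "x \<in> {a..b}" "y \<in> {a..b}" for x y
      using lipschitz_onD[OF lip xy] Basis_le_norm[OF \<open>i \<in> Basis\<close>, of "f x - f y"]
      by (simp add: dist_norm inner_diff_left)
  qed (rule lipschitz_on_nonneg[OF lip])
  then have "negligible {x \<in> {a..b}. \<not> (\<lambda>x. f x \<bullet> i) differentiable (at x within {a..b})}"
    if "i \<in> Basis" for i
    using that lipschitz_real_differentiable_AE by blast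
  then have "negligible (\<Union>i\<in>Basis. {x \<in> {a..b}. \<not> (\<lambda>x. f x \<bullet> i) differentiable (at x within {a..b})})"
    using finite_Basis by (intro negligible_Union) (blast intro: finite_imageI)+
  moreover have "{x \<in> {a..b}. \<not> f differentiable (at x within {a..b})}
    \<subseteq> (\<Union>i\<in>Basis. {x \<in> {a..b}. \<not> (\<lambda>x. f x \<bullet> i) differentiable (at x within {a..b})})"
    using differentiable_componentwise_within by blast
  ultimately show ?thesis by (rule negligible_subset)
qed

subsection \<open>Absolute continuity and lower derivatives of monotone functions\<close>

text \<open>Restricting \<open>r\<close> to the interiors of the intervals leaves at most one
  nonzero term at each point, so the sum of the restrictions is pointwise at most \<open>r\<close>.
  Interiors are taken because the intervals may share endpoints.\<close>

lemma sum_integral_disjoint_intervals_le: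
  fixes r :: "real \<Rightarrow> real" and D :: "(real \<times> real) set"
  assumes r: "r integrable_on {a..b}" "\<And>x. x \<in> {a..b} \<Longrightarrow> 0 \<le> r x"
    and D: "finite D" "\<forall>(c, d)\<in>D. a \<le> c \<and> c \<le> d \<and> d \<le> b"
      "\<forall>p\<in>D. \<forall>q\<in>D. p \<noteq> q \<longrightarrow> {fst p<..<snd p} \<inter> {fst q<..<snd q} = {}"
  shows "(\<Sum>(c, d)\<in>D. integral {c..d} r) \<le> integral {a..b} r"
proof -
  define \<rho> where "\<rho> = (\<lambda>(p :: real \<times> real) x. if x \<in> {fst p<..<snd p} then r x else 0)"
  have ivl: "\<rho> p integrable_on {a..b} \<and> integral {a..b} (\<rho> p) = integral {fst p..snd p} r" if "p \<in> D" for p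
  proof -
    have sub: "{fst p..snd p} \<subseteq> {a..b}" "{fst p<..<snd p} \<inter> {a..b} = {fst p<..<snd p}"
      using D(2) that by auto
    then have "r integrable_on {fst p..snd p}"
      using integrable_on_subinterval[OF r(1)] by blast
    then have "r integrable_on {fst p<..<snd p}"
      by (simp add: integrable_on_open_interval_real)
    then show ?thesis
      unfolding \<rho>_def
      by (simp only: integrable_restrict_Int integral_restrict_Int sub integral_open_interval_real simp_thms)
  qed
  have "(\<Sum>(c, d)\<in>D. integral {c..d} r) = (\<Sum>p\<in>D. integral {a..b} (\<rho> p))"
    using ivl by (intro sum.cong) auto
  also have "\<dots> = integral {a..b} (\<lambda>x. \<Sum>p\<in>D. \<rho> p x)"
    using ivl D(1) by (intro Henstock_Kurzweil_Integration.integral_sum[symmetric]) auto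
  also have "\<dots> \<le> integral {a..b} r"
  proof (rule integral_le)
    show "(\<lambda>x. \<Sum>p\<in>D. \<rho> p x) integrable_on {a..b}"
      using ivl D(1) by (intro integrable_sum) auto
    fix x assume x: "x \<in> {a..b}"
    show "(\<Sum>p\<in>D. \<rho> p x) \<le> r x"
    proof (cases "\<exists>p\<in>D. x \<in> {fst p<..<snd p}")
      case True
      then obtain p where p: "p \<in> D" "x \<in> {fst p<..<snd p}" by blast
      have "(\<Sum>q\<in>D. \<rho> q x) = \<rho> p x + (\<Sum>q\<in>D - {p}. \<rho> q x)"
        using D(1) p(1) by (simp add: sum.remove)
      also have "(\<Sum>q\<in>D - {p}. \<rho> q x) = 0"
      proof (rule sum.neutral, rule ballI)
        fix q assume q: "q \<in> D - {p}"
        with D(3) p have "{fst p<..<snd p} \<inter> {fst q<..<snd q} = {}" by auto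
        with p(2) have "x \<notin> {fst q<..<snd q}" by blast
        then show "\<rho> q x = 0" by (simp only: \<rho>_def if_False)
      qed
      finally show ?thesis using p(2) by (simp add: \<rho>_def)
    next
      case False
      then have "(\<Sum>p\<in>D. \<rho> p x) = 0"
        by (intro sum.neutral) (auto simp: \<rho>_def)
      with r(2) x show ?thesis by simp
    qed
  qed (rule r)
  finally show ?thesis .
qed

text \<open>Truncate \<open>f\<close> at a level \<open>n\<close>. The bounded part contributes at
  most \<open>n\<close> times the total length, and the remainder has a small integral over the
  whole interval by dominated convergence.\<close>

lemma abs_cont_on_indefinite_integral:
  fixes f :: "real \<Rightarrow> real"
  assumes f: "f integrable_on {a..b}" and nonneg: "\<And>x. x \<in> {a..b} \<Longrightarrow> 0 \<le> f x"
  shows "abs_cont_on a b (\<lambda>t. integral {a..t} f)"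
  unfolding abs_cont_on_def
proof (intro allI impI)
  fix \<epsilon> :: real
  assume \<epsilon>: "0 < \<epsilon>"
  define fn where "fn = (\<lambda>n x. min (f x) (real n))"
  have fn: "fn n integrable_on {a..b}" for n
    unfolding fn_def using nonnegative_absolutely_integrable_1[OF f nonneg]
    by (intro set_lebesgue_integral_eq_integral(1) absolutely_integrable_min_1) auto
  have "(\<lambda>n. integral {a..b} (fn n)) \<longlonglongrightarrow> integral {a..b} f"
  proof (rule Equivalence_Lebesgue_Henstock_Integration.dominated_convergence(2)[OF fn f])
    show "norm (fn n x) \<le> f x" if "x \<in> {a..b}" for n x
      using nonneg[OF that] by (simp add: fn_def)
    show "(\<lambda>n. fn n x) \<longlonglongrightarrow> f x" if "x \<in> {a..b}" for x
    proof (rule tendsto_eventually)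
      obtain N where "f x \<le> real N" using real_arch_simple by blast
      then have "fn n x = f x" if "n \<ge> N" for n using that by (simp add: fn_def)
      then show "\<forall>\<^sub>F n in sequentially. fn n x = f x"
        by (auto simp: eventually_sequentially)
    qed
  qed
  then have "\<forall>\<^sub>F n in sequentially. integral {a..b} f - \<epsilon> / 2 < integral {a..b} (fn n)"
    by (rule order_tendstoD) (use \<epsilon> in simp)
  then obtain n where n: "integral {a..b} f - \<epsilon> / 2 < integral {a..b} (fn n)"
    using eventually_happens'[OF sequentially_bot] by blast
  then have n: "integral {a..b} f - integral {a..b} (fn n) < \<epsilon> / 2"
    by simp
  \<comment> \<open>Intervals of this total length contribute at most \<open>\<epsilon> / 2\<close>
    through the truncated part; the summand 1 covers \<open>n = 0\<close>.\<close>
  define \<delta> where "\<delta> = \<epsilon> / (2 * (real n + 1))"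
  show "\<exists>\<delta>>0. \<forall>D. finite D \<and> (\<forall>(c, d)\<in>D. a \<le> c \<and> c \<le> d \<and> d \<le> b) \<and>
      (\<forall>p\<in>D. \<forall>q\<in>D. p \<noteq> q \<longrightarrow> {fst p<..<snd p} \<inter> {fst q<..<snd q} = {}) \<and>
      (\<Sum>(c, d)\<in>D. d - c) < \<delta> \<longrightarrow>
      (\<Sum>(c, d)\<in>D. norm (integral {a..d} f - integral {a..c} f)) < \<epsilon>"
  proof (intro exI[of _ \<delta>] conjI allI impI)
    show "0 < \<delta>" using \<epsilon> by (simp add: \<delta>_def)
    fix D :: "(real \<times> real) set"
    assume "finite D \<and> (\<forall>(c, d)\<in>D. a \<le> c \<and> c \<le> d \<and> d \<le> b) \<and>
      (\<forall>p\<in>D. \<forall>q\<in>D. p \<noteq> q \<longrightarrow> {fst p<..<snd p} \<inter> {fst q<..<snd q} = {}) \<and>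
      (\<Sum>(c, d)\<in>D. d - c) < \<delta>"
    then have D: "finite D" "\<forall>(c, d)\<in>D. a \<le> c \<and> c \<le> d \<and> d \<le> b"
      "\<forall>p\<in>D. \<forall>q\<in>D. p \<noteq> q \<longrightarrow> {fst p<..<snd p} \<inter> {fst q<..<snd q} = {}"
      and lt: "(\<Sum>(c, d)\<in>D. d - c) < \<delta>" by auto
    have diff: "(\<lambda>x. f x - fn n x) integrable_on {a..b}"
      by (intro integrable_diff f fn)
    have "(\<Sum>(c, d)\<in>D. norm (integral {a..d} f - integral {a..c} f))
      \<le> (\<Sum>(c, d)\<in>D. real n * (d - c) + integral {c..d} (\<lambda>x. f x - fn n x))"
    proof (rule sum_mono, clarify)
      fix c d assume "(c, d) \<in> D"
      with D(2) have cd: "a \<le> c" "c \<le> d" "d \<le> b" by auto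
      then have sub: "{c..d} \<subseteq> {a..b}" by auto
      have int: "f integrable_on {c..d}" "fn n integrable_on {c..d}"
        using integrable_on_subinterval[OF f sub] integrable_on_subinterval[OF fn sub] by auto
      have "integral {a..c} f + integral {c..d} f = integral {a..d} f"
        by (rule Henstock_Kurzweil_Integration.integral_combine)
           (use cd in \<open>auto intro: integrable_on_subinterval[OF f]\<close>)
      then have "integral {a..d} f - integral {a..c} f = integral {c..d} f" by simp
      moreover have "0 \<le> integral {c..d} f"
        using int nonneg sub by (intro integral_nonneg) auto
      moreover have "integral {c..d} f = integral {c..d} (fn n) + integral {c..d} (\<lambda>x. f x - fn n x)"
        using int by (simp add: Henstock_Kurzweil_Integration.integral_diff)
      moreover have "integral {c..d} (fn n) \<le> integral {c..d} (\<lambda>x. real n)"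
        by (intro integral_le int integrable_const_ivl) (auto simp: fn_def)
      ultimately show "norm (integral {a..d} f - integral {a..c} f)
          \<le> real n * (d - c) + integral {c..d} (\<lambda>x. f x - fn n x)"
        using cd by (simp add: mult.commute)
    qed
    also have "\<dots> = real n * (\<Sum>(c, d)\<in>D. d - c) + (\<Sum>(c, d)\<in>D. integral {c..d} (\<lambda>x. f x - fn n x))"
      by (simp add: case_prod_beta sum.distrib sum_distrib_left)
    also have "(\<Sum>(c, d)\<in>D. integral {c..d} (\<lambda>x. f x - fn n x)) \<le> integral {a..b} (\<lambda>x. f x - fn n x)"
      by (rule sum_integral_disjoint_intervals_le[OF diff _ D]) (simp add: fn_def)
    also have "\<dots> < \<epsilon> / 2"
      using n f fn by (simp add: Henstock_Kurzweil_Integration.integral_diff)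
    also have "real n * (\<Sum>(c, d)\<in>D. d - c) \<le> real n * \<delta>"
      using lt by (intro mult_left_mono) auto
    also have "real n * \<delta> \<le> \<epsilon> / 2"
      using \<epsilon> by (simp add: \<delta>_def field_simps)
    finally show "(\<Sum>(c, d)\<in>D. norm (integral {a..d} f - integral {a..c} f)) < \<epsilon>"
      by simp
  qed
qed

text \<open>This transfers absolute continuity from a scalar integral to the pair of state and
  second component, whose increments exceed those of the integral by a Lipschitz term only.\<close>

lemma abs_cont_on_dominated:
  fixes f :: "real \<Rightarrow> 'b::real_normed_vector" and g :: "real \<Rightarrow> 'c::real_normed_vector"
  assumes g: "abs_cont_on a b g" and K: "0 \<le> K"
    and le: "\<And>c d. a \<le> c \<Longrightarrow> c \<le> d \<Longrightarrow> d \<le> b \<Longrightarrow> norm (f d - f c) \<le> K * (d - c) + norm (g d - g c)"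
  shows "abs_cont_on a b f"
  unfolding abs_cont_on_def
proof (intro allI impI)
  fix \<epsilon> :: real
  assume \<epsilon>: "0 < \<epsilon>"
  then have "0 < \<epsilon> / 2" by simp
  with g obtain \<delta> where \<delta>: "0 < \<delta>" and
    *: "\<And>D :: (real \<times> real) set. finite D \<and> (\<forall>(c, d)\<in>D. a \<le> c \<and> c \<le> d \<and> d \<le> b) \<and>
      (\<forall>p\<in>D. \<forall>q\<in>D. p \<noteq> q \<longrightarrow> {fst p<..<snd p} \<inter> {fst q<..<snd q} = {}) \<and>
      (\<Sum>(c, d)\<in>D. d - c) < \<delta> \<Longrightarrow> (\<Sum>(c, d)\<in>D. norm (g d - g c)) < \<epsilon> / 2"
    unfolding abs_cont_on_def by blast
  define \<delta>' where "\<delta>' = min \<delta> (\<epsilon> / (2 * (K + 1)))"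
  show "\<exists>\<delta>>0. \<forall>D. finite D \<and> (\<forall>(c, d)\<in>D. a \<le> c \<and> c \<le> d \<and> d \<le> b) \<and>
      (\<forall>p\<in>D. \<forall>q\<in>D. p \<noteq> q \<longrightarrow> {fst p<..<snd p} \<inter> {fst q<..<snd q} = {}) \<and>
      (\<Sum>(c, d)\<in>D. d - c) < \<delta> \<longrightarrow> (\<Sum>(c, d)\<in>D. norm (f d - f c)) < \<epsilon>"
  proof (intro exI[of _ \<delta>'] conjI allI impI)
    show "0 < \<delta>'" using \<delta> \<epsilon> K by (simp add: \<delta>'_def)
    fix D :: "(real \<times> real) set"
    assume D: "finite D \<and> (\<forall>(c, d)\<in>D. a \<le> c \<and> c \<le> d \<and> d \<le> b) \<and>
      (\<forall>p\<in>D. \<forall>q\<in>D. p \<noteq> q \<longrightarrow> {fst p<..<snd p} \<inter> {fst q<..<snd q} = {}) \<and>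
      (\<Sum>(c, d)\<in>D. d - c) < \<delta>'"
    have "(\<Sum>(c, d)\<in>D. norm (f d - f c)) \<le> (\<Sum>(c, d)\<in>D. K * (d - c) + norm (g d - g c))"
      using D le by (intro sum_mono) auto
    also have "\<dots> = K * (\<Sum>(c, d)\<in>D. d - c) + (\<Sum>(c, d)\<in>D. norm (g d - g c))"
      by (simp add: case_prod_beta sum.distrib sum_distrib_left)
    also have "(\<Sum>(c, d)\<in>D. norm (g d - g c)) < \<epsilon> / 2"
      using D by (intro *) (auto simp: \<delta>'_def)
    also have "K * (\<Sum>(c, d)\<in>D. d - c) \<le> K * (\<epsilon> / (2 * (K + 1)))"
      using D K by (intro mult_left_mono) (auto simp: \<delta>'_def)
    also have "\<dots> \<le> \<epsilon> / 2"
      using \<epsilon> K by (simp add: field_simps)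
    finally show "(\<Sum>(c, d)\<in>D. norm (f d - f c)) < \<epsilon>" by simp
  qed
qed

text \<open>After a shift of the second term the integrals cancel except over two strips of width
  \<open>h\<close>. On the strip ending at \<open>b\<close> the function is at most
  \<open>H b\<close>, and on the one ending at \<open>a\<close> it equals
  \<open>H a\<close>.\<close>

lemma integral_backward_difference_le:
  fixes H :: "real \<Rightarrow> real"
  assumes H: "mono H" and left: "\<And>x. x \<le> a \<Longrightarrow> H x = H a" and h: "0 < h" and ab: "a \<le> b"
  shows "(\<lambda>x. H x - H (x - h)) integrable_on {a..b}"
    "integral {a..b} (\<lambda>x. H x - H (x - h)) \<le> h * (H b - H a)"
proof -
  have int: "H integrable_on {c..d}" for c d
    by (rule integrable_on_mono_on) (use H in \<open>auto simp: mono_on_def mono_def\<close>)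
  have shift: "((\<lambda>x. H (x - h)) has_integral integral {a - h..b - h} H) {a..b}"
    using has_integral_shift_real_ivl[OF integrable_integral[OF int, of "a - h" "b - h"], of "-h"] by simp
  then show "(\<lambda>x. H x - H (x - h)) integrable_on {a..b}"
    using int by (intro integrable_diff) auto
  have "integral {a..b} (\<lambda>x. H x - H (x - h)) = integral {a..b} H - integral {a - h..b - h} H"
    using shift int by (subst Henstock_Kurzweil_Integration.integral_diff) (auto simp: integral_unique)
  also have "\<dots> = integral {b - h..b} H - integral {a - h..a} H"
  proof -
    have "integral {a - h..a} H + integral {a..b} H = integral {a - h..b} H"
      using ab h int by (intro Henstock_Kurzweil_Integration.integral_combine) auto
    moreover have "integral {a - h..b - h} H + integral {b - h..b} H = integral {a - h..b} H"
      using ab h int by (intro Henstock_Kurzweil_Integration.integral_combine) auto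
    ultimately show ?thesis by linarith
  qed
  also have "integral {b - h..b} H \<le> integral {b - h..b} (\<lambda>x. H b)"
    using H by (intro integral_le int integrable_const_ivl) (auto simp: mono_def)
  also have "integral {a - h..a} H = integral {a - h..a} (\<lambda>x. H a)"
    by (rule Henstock_Kurzweil_Integration.integral_cong) (rule left, simp)
  finally show "integral {a..b} (\<lambda>x. H x - H (x - h)) \<le> h * (H b - H a)"
    using h by (simp add: algebra_simps)
qed

text \<open>The function \<open>l\<close> is the lower limit of the backward difference quotients of \<open>G\<close>; Fatou's lemma
  discards the jumps and the singular part of \<open>G\<close>.\<close>

lemma mono_on_lower_derivative:
  fixes G :: "real \<Rightarrow> real"
  assumes G: "mono_on {a..b} G" and ab: "a \<le> b"
  obtains l where "\<And>x. 0 \<le> l x" "l integrable_on {a..b}"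
    "\<And>t. t \<in> {a..b} \<Longrightarrow> integral {a..t} l \<le> G t - G a"
    "negligible {x \<in> {a<..b}. \<not> (\<forall>y>l x. \<exists>\<^sub>F n in sequentially.
        real (Suc n) * (G x - G (x - 1 / real (Suc n))) < y)}"
proof -
  \<comment> \<open>The constant extension makes backward quotients meaningful to the left of
    \<open>a\<close> and supplies the hypothesis of
    \<open>integral_backward_difference_le\<close>.\<close>
  define H where "H x = G (max a (min b x))" for x
  have H: "mono H"
    using G ab by (auto simp: mono_def H_def mono_on_def)
  have H_eq: "H x = G x" if "x \<in> {a..b}" for x using that by (simp add: H_def)
  have left: "H x = H a" if "x \<le> a" for x using that ab by (simp add: H_def max_def min_def)
  have H_meas[measurable]: "H \<in> borel_measurable borel" using H by (rule borel_measurable_mono)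
  define q where "q n x = real (Suc n) * (H x - H (x - 1 / real (Suc n)))" for n x
  have q_nonneg: "0 \<le> q n x" for n x
    using H by (auto simp: q_def mono_def)
  have q_meas[measurable]: "q n \<in> borel_measurable borel" for n
    unfolding q_def by measurable
  define le where "le x = liminf (\<lambda>n. ennreal (q n x))" for x
  have le_meas[measurable]: "le \<in> borel_measurable borel" unfolding le_def by measurable
  have le_int: "(\<integral>\<^sup>+x. le x * indicator {a..t} x \<partial>lborel) \<le> ennreal (G t - G a)" if t: "t \<in> {a..b}" for t
  proof -
    have q_int: "(\<integral>\<^sup>+x. ennreal (q n x) * indicator {a..t} x \<partial>lborel) \<le> ennreal (G t - G a)" for n
    proof -
      note I = integral_backward_difference_le[OF H left, of "1 / real (Suc n)" t]
      have "(q n has_integral (real (Suc n) * integral {a..t} (\<lambda>x. H x - H (x - 1 / real (Suc n))))) {a..t}"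
        unfolding q_def using I(1) t by (intro has_integral_mult_right) (simp add: integrable_integral)
      then have "(\<integral>\<^sup>+x. ennreal (q n x) * indicator {a..t} x \<partial>lborel)
          = ennreal (real (Suc n) * integral {a..t} (\<lambda>x. H x - H (x - 1 / real (Suc n))))"
        using q_nonneg by (intro nn_integral_has_integral_lebesgue') auto
      also have "\<dots> \<le> ennreal (real (Suc n) * (1 / real (Suc n) * (H t - H a)))"
        by (intro ennreal_leI mult_left_mono I(2)) (use t in auto)
      also have "\<dots> = ennreal (G t - G a)"
        using t ab by (simp add: H_eq)
      finally show ?thesis .
    qed
    have "(\<integral>\<^sup>+x. le x * indicator {a..t} x \<partial>lborel)
        \<le> (\<integral>\<^sup>+x. liminf (\<lambda>n. ennreal (q n x) * indicator {a..t} x) \<partial>lborel)"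
      unfolding le_def by (intro nn_integral_mono) (auto simp: indicator_def)
    also have "\<dots> \<le> liminf (\<lambda>n. \<integral>\<^sup>+x. ennreal (q n x) * indicator {a..t} x \<partial>lborel)"
      by (rule nn_integral_liminf) measurable
    also have "\<dots> \<le> liminf (\<lambda>n. ennreal (G t - G a))"
      by (intro Liminf_mono always_eventually allI q_int)
    finally show ?thesis by (simp add: Liminf_const)
  qed
  have "(\<integral>\<^sup>+x. le x * indicator {a..b} x \<partial>lborel) < \<infinity>"
    using le_int[of b] ab by (auto intro: le_less_trans)
  then have fin: "AE x in lborel. le x * indicator {a..b} x \<noteq> \<infinity>"
    by (intro nn_integral_noteq_infinite) auto
  define l where "l x = enn2real (le x)" for x
  have l: "l integrable_on {a..t} \<and> integral {a..t} l \<le> G t - G a" if t: "t \<in> {a..b}" for t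
  proof -
    have "AE x in lborel. ennreal (l x * indicator {a..t} x) = le x * indicator {a..t} x"
      using fin by eventually_elim (use t in \<open>auto simp: indicator_def l_def less_top\<close>)
    then have eq: "(\<integral>\<^sup>+x. ennreal (l x * indicator {a..t} x) \<partial>lborel) = (\<integral>\<^sup>+x. le x * indicator {a..t} x \<partial>lborel)"
      by (rule nn_integral_cong_AE)
    have Gt: "0 \<le> G t - G a" using G t ab by (auto simp: mono_on_def)
    obtain r where r: "0 \<le> r" "(\<integral>\<^sup>+x. le x * indicator {a..t} x \<partial>lborel) = ennreal r" "r \<le> G t - G a"
      using le_int[OF t] Gt by (cases "\<integral>\<^sup>+x. le x * indicator {a..t} x \<partial>lborel") (auto simp: top_unique)
    have "((\<lambda>x. l x * indicator {a..t} x) has_integral r) UNIV"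
      by (rule nn_integral_has_integral) (use eq r in \<open>auto simp: l_def\<close>)
    moreover have "(\<lambda>x. l x * indicator {a..t} x) = (\<lambda>x. if x \<in> {a..t} then l x else 0)"
      by (auto simp: indicator_def)
    ultimately have "(l has_integral r) {a..t}"
      by (simp only: has_integral_restrict_UNIV)
    with r(3) show ?thesis by (auto simp: integral_unique)
  qed
  show thesis
  proof (rule that)
    show "0 \<le> l x" for x by (simp add: l_def)
    show "l integrable_on {a..b}" using l[of b] ab by simp
    show "integral {a..t} l \<le> G t - G a" if "t \<in> {a..b}" for t using l[OF that] by simp
    \<comment> \<open>Only points with an infinite lower limit are exceptional. Elsewhere
      \<open>l x\<close> is the lower limit itself, so the quotients cannot eventually stay above
      some \<open>y > l x\<close>.\<close>
    have "{x \<in> {a<..b}. \<not> (\<forall>y>l x. \<exists>\<^sub>F n in sequentially.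
        real (Suc n) * (G x - G (x - 1 / real (Suc n))) < y)} \<subseteq> {x. le x * indicator {a..b} x = \<infinity>}"
    proof (rule subsetI, rule ccontr)
      fix x
      assume "x \<notin> {x. le x * indicator {a..b} x = \<infinity>}"
        and *: "x \<in> {x \<in> {a<..b}. \<not> (\<forall>y>l x. \<exists>\<^sub>F n in sequentially.
          real (Suc n) * (G x - G (x - 1 / real (Suc n))) < y)}"
      then have x: "x \<in> {a<..b}" "le x \<noteq> \<infinity>" by auto
      from * obtain y where y: "l x < y"
        and "\<not> (\<exists>\<^sub>F n in sequentially. real (Suc n) * (G x - G (x - 1 / real (Suc n))) < y)"
        by blast
      then have ev: "\<forall>\<^sub>F n in sequentially. y \<le> real (Suc n) * (G x - G (x - 1 / real (Suc n)))"
        by (simp add: not_frequently not_less)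
      \<comment> \<open>Since \<open>x > a\<close>, the shifted points eventually lie in
        \<open>[a, b]\<close>, where \<open>H\<close> and \<open>G\<close> coincide.\<close>
      have "(\<lambda>n. x - 1 / real (Suc n)) \<longlonglongrightarrow> x - 0"
        by (intro tendsto_intros) (use LIMSEQ_inverse_real_of_nat in \<open>simp add: inverse_eq_divide\<close>)
      then have "\<forall>\<^sub>F n in sequentially. a < x - 1 / real (Suc n)"
        by (rule order_tendstoD) (use x in simp)
      with ev have "\<forall>\<^sub>F n in sequentially. ennreal y \<le> ennreal (q n x)"
      proof eventually_elim
        case (elim n)
        have "0 < 1 / real (Suc n)" by simp
        with x have "x - 1 / real (Suc n) \<le> b" unfolding greaterThanAtMost_iff by linarith
        then have "q n x = real (Suc n) * (G x - G (x - 1 / real (Suc n)))"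
          unfolding q_def using x elim by (simp add: H_eq del: of_nat_Suc)
        with elim show ?case by (intro ennreal_leI) simp
      qed
      then have "ennreal y \<le> le x" unfolding le_def by (rule Liminf_bounded)
      moreover have "le x = ennreal (l x)" using x(2) by (simp add: l_def less_top)
      moreover have "0 \<le> l x" by (simp add: l_def)
      ultimately show False using y by (simp add: ennreal_le_iff2)
    qed
    moreover have "negligible {x. le x * indicator {a..b} x = \<infinity>}"
    proof -
      have "{x. le x * indicator {a..b} x = \<infinity>} \<in> null_sets lborel"
        using fin by (subst AE_iff_null_sets) auto
      then show ?thesis by (simp add: negligible_iff_null_sets null_sets_completionI)
    qed
    ultimately show "negligible {x \<in> {a<..b}. \<not> (\<forall>y>l x. \<exists>\<^sub>F n in sequentially.
        real (Suc n) * (G x - G (x - 1 / real (Suc n))) < y)}"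
      using negligible_subset by blast
  qed
qed

subsection \<open>Viability by proximal aiming\<close>

text \<open>If a tangent direction \<zeta> made an acute angle with \<open>z - s\<close>, then a
  short move from \<open>s\<close> along \<zeta>, corrected by a small multiple of its length so as
  to land in \<open>K\<close>, would produce a point of \<open>K\<close> closer to \<open>z\<close>:
  the gain is linear in \<tau> and the loss quadratic.\<close>

lemma proximal_normal_in_normal_cone:
  fixes K :: "'b::euclidean_space set"
  assumes K: "closed K" "s \<in> K" and dist: "dist z s = infdist z K"
  shows "z - s \<in> normal_cone K s"
  unfolding normal_cone_def
proof (clarify, rule ccontr)
  fix \<zeta>
  assume \<zeta>: "\<zeta> \<in> tangent_cone K s" and "\<not> inner \<zeta> (z - s) \<le> 0"
  define n m where "n = z - s" and "m = inner \<zeta> n"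
  have m: "0 < m" using \<open>\<not> inner \<zeta> (z - s) \<le> 0\<close> by (simp add: m_def n_def)
  \<comment> \<open>With this tolerance the correction \<open>w\<close> costs at most half of the
    linear gain \<open>\<tau> * m\<close>.\<close>
  define e where "e = m / (2 * (norm n + 1))"
  have e: "0 < e" "norm n * e \<le> m / 2"
    using m by (auto simp: e_def field_simps add_pos_nonneg)
  define A where "A = (norm \<zeta> + e)\<^sup>2 + 1"
  have A: "0 < A" by (simp add: A_def add_nonneg_pos)
  \<comment> \<open>Below \<delta> the quadratic term \<open>\<tau> * (\<tau> * A)\<close>, which
    bounds the squared length of the displacement \<open>g\<close>, is smaller than
    \<open>\<tau> * m\<close>.\<close>
  define \<delta> where "\<delta> = m / A"
  have \<delta>: "0 < \<delta>" using m A by (simp add: \<delta>_def)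
  have "\<exists>\<^sub>F \<tau> in at_right 0. infdist (s + \<tau> *\<^sub>R \<zeta>) K / \<tau> < e"
  proof (rule ccontr)
    assume "\<not> ?thesis"
    then have "\<forall>\<^sub>F \<tau> in at_right 0. ereal e \<le> ereal (infdist (s + \<tau> *\<^sub>R \<zeta>) K / \<tau>)"
      by (simp add: not_frequently not_less)
    then have "ereal e \<le> Liminf (at_right 0) (\<lambda>\<tau>. ereal (infdist (s + \<tau> *\<^sub>R \<zeta>) K / \<tau>))"
      by (rule Liminf_bounded)
    with \<zeta> e show False by (simp add: tangent_cone_def)
  qed
  moreover have "\<forall>\<^sub>F \<tau> in at_right 0. \<tau> \<in> {0<..<\<delta>}"
    using eventually_at_right_real[OF \<delta>] .
  ultimately have "\<exists>\<^sub>F \<tau> in at_right 0. infdist (s + \<tau> *\<^sub>R \<zeta>) K / \<tau> < e \<and> \<tau> \<in> {0<..<\<delta>}"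
    by (rule frequently_eventually_frequently)
  from frequently_ex[OF this]
  obtain \<tau> where \<tau>: "0 < \<tau>" "\<tau> < \<delta>" "infdist (s + \<tau> *\<^sub>R \<zeta>) K / \<tau> < e"
    by auto
  obtain y where y: "y \<in> K" "infdist (s + \<tau> *\<^sub>R \<zeta>) K = dist (s + \<tau> *\<^sub>R \<zeta>) y"
    using infdist_attains_inf K by blast
  define w where "w = s + \<tau> *\<^sub>R \<zeta> - y"
  have w: "norm w \<le> e * \<tau>"
    using \<tau> y by (simp add: w_def dist_norm field_simps)
  define g where "g = \<tau> *\<^sub>R \<zeta> - w"
  have zy: "z - y = n - g" by (simp add: g_def n_def w_def)
  have "norm n \<le> norm (z - y)"
    using infdist_le[OF y(1), of z] dist by (simp add: n_def dist_norm)
  \<comment> \<open>Since \<open>s\<close> is a closest point, \<open>y\<close> is no closer to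
    \<open>z\<close>; expanding the square bounds the linear gain by the quadratic term.\<close>
  then have "(norm n)\<^sup>2 \<le> (norm (n - g))\<^sup>2" unfolding zy by (simp add: power_mono)
  then have 1: "2 * inner n g \<le> (norm g)\<^sup>2"
    by (simp add: power2_norm_eq_inner inner_diff_left inner_diff_right inner_commute)
  have "inner n g = \<tau> * m - inner n w"
    by (simp add: g_def inner_diff_right m_def inner_commute)
  moreover have "inner n w \<le> norm n * (e * \<tau>)"
    using norm_cauchy_schwarz[of n w] w by (meson mult_left_mono norm_ge_zero order_trans)
  moreover have "norm n * (e * \<tau>) \<le> \<tau> * (m / 2)"
    using mult_left_mono[OF e(2), of \<tau>] \<tau> by (simp add: algebra_simps)
  ultimately have 2: "\<tau> * m \<le> 2 * inner n g" by (simp add: algebra_simps)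
  have "norm g \<le> \<tau> * (norm \<zeta> + e)"
    using norm_triangle_ineq4[of "\<tau> *\<^sub>R \<zeta>" w] w \<tau> by (simp add: g_def algebra_simps)
  then have "(norm g)\<^sup>2 \<le> (\<tau> * (norm \<zeta> + e))\<^sup>2" by (simp add: power_mono)
  also have "\<dots> \<le> \<tau> * (\<tau> * A)"
    using \<tau> by (simp add: A_def power_mult_distrib power2_eq_square algebra_simps)
  finally have "\<tau> * m \<le> \<tau> * (\<tau> * A)" using 1 2 by linarith
  then have "m \<le> \<tau> * A" using \<tau> by simp
  moreover have "\<tau> * A < m" using \<tau> A by (simp add: \<delta>_def field_simps)
  ultimately show False by simp
qed

text \<open>For nonnegative \<open>s\<close> and \<open>h\<close> this is the length of the part of
  \<open>[0, s]\<close> inside the \<open>i\<close>-th step \<open>[i * h, (i + 1) * h]\<close>. It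
  writes an Euler polygon as one sum, whose increments are combinations of the velocities with
  nonnegative weights adding up to the elapsed time.\<close>

definition ramp_weight :: "real \<Rightarrow> nat \<Rightarrow> real \<Rightarrow> real" where
  "ramp_weight h i s = max 0 (min h (s - real i * h))"

lemma sum_ramp_weight:
  assumes "0 \<le> s" "0 \<le> h"
  shows "(\<Sum>i<N. ramp_weight h i s) = min s (real N * h)"
proof (induction N)
  case (Suc N)
  have "(1 + real N) * h = real N * h + h" by (simp add: algebra_simps)
  with Suc assms show ?case by (auto simp: ramp_weight_def)
qed (use assms in simp)

lemma ramp_weight_node:
  assumes "0 \<le> h"
  shows "ramp_weight h i (real k * h) = (if i < k then h else 0)"
proof (cases "i < k")
  case True
  then have "(real i + 1) * h \<le> real k * h"
    using assms by (intro mult_right_mono) auto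
  with True assms show ?thesis by (simp add: ramp_weight_def algebra_simps)
next
  case False
  then have "real k * h \<le> real i * h"
    using assms by (intro mult_right_mono) auto
  with False show ?thesis by (simp add: ramp_weight_def)
qed

text \<open>By the aiming condition each step raises the squared distance to \<open>K\<close> by at
  most \<open>h * h * (2 + B^2)\<close>; the second summand of \<open>\<eta>\<close> is the way
  covered within one step. The last conclusion describes the velocities only through bounds on
  linear functionals, a form that survives uniform limits.\<close>

lemma euler_polygon_proximal_aiming:
  fixes K :: "'b::euclidean_space set" and P :: "'b \<Rightarrow> 'b \<Rightarrow> bool"
  assumes K: "closed K" "z0 \<in> K" and B: "0 < B" and h: "0 < h" and N: "real N * h * B \<le> \<rho>"
    and aim: "\<And>z s. z \<in> cball z0 \<rho> \<Longrightarrow> s \<in> K \<Longrightarrow> dist z s = infdist z K \<Longrightarrow>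
      \<exists>f. P s f \<and> norm f \<le> B \<and> inner f (z - s) \<le> h"
    and \<eta>_def: "\<eta> = sqrt (real N * h * h * (2 + B\<^sup>2)) + B * h"
  obtains Z where "Z 0 = z0" "\<And>s1 s2. 0 \<le> s1 \<Longrightarrow> s1 \<le> s2 \<Longrightarrow> s2 \<le> real N * h \<Longrightarrow> norm (Z s2 - Z s1) \<le> B * (s2 - s1)"
    "\<And>s. s \<in> {0..real N * h} \<Longrightarrow> infdist (Z s) K \<le> \<eta>"
    "\<And>q c s1 s2. 0 \<le> s1 \<Longrightarrow> s1 \<le> s2 \<Longrightarrow> s2 \<le> real N * h \<Longrightarrow>
       (\<And>s y f. s \<in> {s1..s2} \<Longrightarrow> y \<in> K \<Longrightarrow> dist y (Z s) \<le> \<eta> \<Longrightarrow> P y f \<Longrightarrow> inner q f \<le> c) \<Longrightarrow>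
       inner q (Z s2 - Z s1) \<le> c * (s2 - s1)"
proof -
  have "\<exists>s f. s \<in> K \<and> dist z s = infdist z K \<and> P s f \<and> norm f \<le> B \<and> inner f (z - s) \<le> h"
    if "z \<in> cball z0 \<rho>" for z
    using infdist_attains_inf[of K z] K aim[OF that] by (metis empty_iff)
  then obtain \<sigma> \<phi> where step: "\<And>z. z \<in> cball z0 \<rho> \<Longrightarrow>
     \<sigma> z \<in> K \<and> dist z (\<sigma> z) = infdist z K \<and> P (\<sigma> z) (\<phi> z) \<and> norm (\<phi> z) \<le> B \<and> inner (\<phi> z) (z - \<sigma> z) \<le> h"
    by metis
  define x where "x i = ((\<lambda>z. z + h *\<^sub>R \<phi> z) ^^ i) z0" for i
  define f where "f i = \<phi> (x i)" for i
  have x0: "x 0 = z0" and x_Suc: "x (Suc i) = x i + h *\<^sub>R f i" for i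
    by (simp_all add: x_def f_def)
  have dist_x: "dist z0 (x i) \<le> real i * h * B" if "i \<le> N" for i
    using that
  proof (induction i)
    case (Suc i)
    then have le: "dist z0 (x i) \<le> real i * h * B" by simp
    moreover have "real i * h * B \<le> real N * h * B"
      using Suc h B by (intro mult_right_mono) auto
    ultimately have "x i \<in> cball z0 \<rho>" using N by simp
    then have "norm (f i) \<le> B" using step by (simp add: f_def)
    then have "norm (h *\<^sub>R f i) \<le> h * B" using h by simp
    moreover have "dist z0 (x (Suc i)) \<le> dist z0 (x i) + norm (h *\<^sub>R f i)"
      using dist_triangle[of z0 "x (Suc i)" "x i"] by (simp add: x_Suc dist_norm)
    ultimately show ?case using le by (simp add: algebra_simps)
  qed (simp add: x0)
  have in_ball: "x i \<in> cball z0 \<rho>" if "i \<le> N" for i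
  proof -
    have "real i * h * B \<le> real N * h * B"
      using that h B by (intro mult_right_mono) auto
    with dist_x[OF that] N show ?thesis by simp
  qed
  note st = step[OF in_ball, folded f_def]
  \<comment> \<open>The closest point of the old node is also a competitor for the new node. In the
    expanded square the cross term is at most \<open>2 * h * h\<close> by aiming.\<close>
  have d2: "(infdist (x i) K)\<^sup>2 \<le> real i * h * h * (2 + B\<^sup>2)" if "i \<le> N" for i
    using that
  proof (induction i)
    case (Suc i)
    then have i: "i \<le> N" by simp
    let ?n = "x i - \<sigma> (x i)"
    have "infdist (x (Suc i)) K \<le> norm (?n + h *\<^sub>R f i)"
      using infdist_le[of "\<sigma> (x i)" K "x (Suc i)"] st[OF i] by (simp add: dist_norm x_Suc algebra_simps)
    then have "(infdist (x (Suc i)) K)\<^sup>2 \<le> (norm (?n + h *\<^sub>R f i))\<^sup>2"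
      by (simp add: power_mono infdist_nonneg)
    also have "(norm (n + h *\<^sub>R f i))\<^sup>2 = (norm n)\<^sup>2 + 2 * h * inner (f i) n + h\<^sup>2 * (norm (f i))\<^sup>2" for n
      by (simp add: power2_norm_eq_inner inner_add_left inner_add_right inner_commute algebra_simps
          power2_eq_square[of h])
    also have "(norm ?n)\<^sup>2 = (infdist (x i) K)\<^sup>2" using st[OF i] by (simp add: dist_norm)
    also have "2 * h * inner (f i) ?n \<le> 2 * h * h" using st[OF i] h by simp
    also have "h\<^sup>2 * (norm (f i))\<^sup>2 \<le> h\<^sup>2 * B\<^sup>2"
      using st[OF i] by (intro mult_left_mono power_mono) auto
    finally show ?case using Suc.IH[OF i] by (simp add: algebra_simps power2_eq_square)
  qed (use K in \<open>simp add: x0\<close>)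
  have d: "infdist (x i) K \<le> sqrt (real N * h * h * (2 + B\<^sup>2))" if "i \<le> N" for i
  proof (rule real_le_rsqrt)
    have "real i * h * h * (2 + B\<^sup>2) \<le> real N * h * h * (2 + B\<^sup>2)"
      using that h by (intro mult_right_mono) auto
    with d2[OF that] show "(infdist (x i) K)\<^sup>2 \<le> real N * h * h * (2 + B\<^sup>2)" by linarith
  qed
  define Z where "Z s = z0 + (\<Sum>i<N. ramp_weight h i s *\<^sub>R f i)" for s
  have x_sum: "x k = z0 + (\<Sum>i<k. h *\<^sub>R f i)" for k
    by (induction k) (simp_all add: x0 x_Suc algebra_simps)
  have Z_node: "Z (real k * h) = x k" if "k \<le> N" for k
  proof -
    have "(\<Sum>i<N. ramp_weight h i (real k * h) *\<^sub>R f i) = (\<Sum>i<N. if i < k then h *\<^sub>R f i else 0)"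
      using h by (intro sum.cong) (auto simp: ramp_weight_node)
    also have "\<dots> = (\<Sum>i<k. h *\<^sub>R f i)"
      using that by (simp add: sum.If_cases) (rule sum.cong, auto)
    finally show ?thesis by (simp add: Z_def x_sum)
  qed
  define w where "w s1 s2 i = ramp_weight h i s2 - ramp_weight h i s1" for s1 s2 i
  have w_nonneg: "0 \<le> w s1 s2 i" if "s1 \<le> s2" for s1 s2 i
    using that by (auto simp: w_def ramp_weight_def)
  have w_sum: "(\<Sum>i<N. w s1 s2 i) = s2 - s1" if "0 \<le> s1" "s1 \<le> s2" "s2 \<le> real N * h" for s1 s2
    using that h by (simp add: w_def sum_subtractf sum_ramp_weight)
  have Z_diff: "Z s2 - Z s1 = (\<Sum>i<N. w s1 s2 i *\<^sub>R f i)" for s1 s2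
    by (simp add: Z_def w_def sum_subtractf algebra_simps)
  have lip: "norm (Z s2 - Z s1) \<le> B * (s2 - s1)" if s: "0 \<le> s1" "s1 \<le> s2" "s2 \<le> real N * h" for s1 s2
  proof -
    have "norm (Z s2 - Z s1) \<le> (\<Sum>i<N. w s1 s2 i * B)"
      unfolding Z_diff
    proof (rule sum_norm_le)
      fix i assume "i \<in> {..<N}"
      then have "norm (f i) \<le> B" using st by simp
      then show "norm (w s1 s2 i *\<^sub>R f i) \<le> w s1 s2 i * B"
        using w_nonneg[OF s(2)] by (simp add: mult_left_mono)
    qed
    also have "\<dots> = B * (s2 - s1)"
      using w_sum[OF s] by (simp flip: sum_distrib_right)
    finally show ?thesis .
  qed
  have near: "dist (Z s) (x i) \<le> B * h" if "real i * h \<le> s" "s \<le> real i * h + h" "s \<le> real N * h" "i \<le> N" for s i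
  proof -
    have "norm (Z s - Z (real i * h)) \<le> B * (s - real i * h)"
      using that h by (intro lip) auto
    also have "\<dots> \<le> B * h" using that B by (intro mult_left_mono) auto
    finally show ?thesis using Z_node[OF that(4)] by (simp add: dist_norm)
  qed
  show thesis
  proof (rule that)
    show "Z 0 = z0" using Z_node[of 0] by (simp add: x0)
    show "norm (Z s2 - Z s1) \<le> B * (s2 - s1)" if "0 \<le> s1" "s1 \<le> s2" "s2 \<le> real N * h" for s1 s2
      using lip that .
    show "infdist (Z s) K \<le> \<eta>" if s: "s \<in> {0..real N * h}" for s
    proof -
      \<comment> \<open>This is the last node time not exceeding \<open>s\<close>; at the final time
        it is node \<open>N\<close>.\<close>
      define i where "i = nat \<lfloor>s / h\<rfloor>"
      have i: "real i \<le> s / h" "s / h < real i + 1"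
        using s h by (auto simp: i_def)
      then have ih: "real i * h \<le> s" "s \<le> real i * h + h" using h by (auto simp: field_simps)
      have "s / h \<le> real N" using s h by (simp add: field_simps)
      with i(1) have iN: "i \<le> N" by linarith
      have "infdist (Z s) K \<le> infdist (x i) K + dist (Z s) (x i)"
        by (rule infdist_triangle)
      also have "\<dots> \<le> \<eta>"
        unfolding \<eta>_def using near[OF ih _ iN] d[OF iN] s by (intro add_mono) auto
      finally show ?thesis .
    qed
    show "inner q (Z s2 - Z s1) \<le> c * (s2 - s1)"
      if s: "0 \<le> s1" "s1 \<le> s2" "s2 \<le> real N * h"
        and q: "\<And>s y f. s \<in> {s1..s2} \<Longrightarrow> y \<in> K \<Longrightarrow> dist y (Z s) \<le> \<eta> \<Longrightarrow> P y f \<Longrightarrow> inner q f \<le> c"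
      for q c s1 s2
    proof -
      have "inner q (Z s2 - Z s1) = (\<Sum>i<N. w s1 s2 i * inner q (f i))"
        by (simp add: Z_diff inner_sum_right)
      also have "\<dots> \<le> (\<Sum>i<N. w s1 s2 i * c)"
      proof (rule sum_mono)
        fix i assume "i \<in> {..<N}"
        then have i: "i \<le> N" by simp
        show "w s1 s2 i * inner q (f i) \<le> w s1 s2 i * c"
        proof (cases "w s1 s2 i = 0")
          case False
          \<comment> \<open>Only steps that overlap \<open>[s1, s2]\<close> carry weight. The time
            \<open>max s1 (real i * h)\<close> belongs to both, and the polygon there is within
            \<open>B * h\<close> of the node, hence within \<eta> of the closest point at which the
            velocity was chosen.\<close>
          with w_nonneg[OF s(2)] have "0 < w s1 s2 i" by (simp add: less_le)
          then have "real i * h < s2" "s1 < real i * h + h"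
            using h s by (auto simp: w_def ramp_weight_def max_def min_def split: if_splits)
          then have "dist (Z (max s1 (real i * h))) (x i) \<le> B * h"
            using s i h by (intro near) auto
          moreover have "dist (\<sigma> (x i)) (x i) \<le> sqrt (real N * h * h * (2 + B\<^sup>2))"
            using st[OF i] d[OF i] by (simp add: dist_commute)
          ultimately have "dist (\<sigma> (x i)) (Z (max s1 (real i * h))) \<le> \<eta>"
            unfolding \<eta>_def using dist_triangle2[of "\<sigma> (x i)" "Z (max s1 (real i * h))" "x i"] by linarith
          then have "inner q (f i) \<le> c"
            using st[OF i] \<open>real i * h < s2\<close> s by (intro q[of "max s1 (real i * h)" "\<sigma> (x i)"]) auto
          with w_nonneg[OF s(2)] show ?thesis by (simp add: mult_left_mono)
        qed simp
      qed
      also have "\<dots> = c * (s2 - s1)"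
        using w_sum[OF s] by (simp flip: sum_distrib_right)
      finally show ?thesis .
    qed
  qed
qed

text \<open>The polygons are uniformly Lipschitz and their distance to \<open>K\<close> tends to 0,
  so a uniformly convergent subsequence has its limit in the closed set \<open>K\<close>. A bound on
  a functional over all admissible velocities near the limit holds for the late polygons and passes
  to the limit.\<close>

theorem viability_proximal_aiming:
  fixes K :: "'b::euclidean_space set" and P :: "real \<Rightarrow> 'b \<Rightarrow> 'b \<Rightarrow> bool"
  assumes K: "closed K" "z0 \<in> K" and B: "0 < B" and \<rho>: "0 < \<rho>"
    and aim: "\<And>\<epsilon> z s. 0 < \<epsilon> \<Longrightarrow> z \<in> cball z0 \<rho> \<Longrightarrow> s \<in> K \<Longrightarrow> dist z s = infdist z K \<Longrightarrow>
      \<exists>f. P \<epsilon> s f \<and> norm f \<le> B \<and> inner f (z - s) \<le> \<epsilon>"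
  obtains Z where "Z 0 = z0" "continuous_on {0..\<rho> / B} Z" "\<And>s. s \<in> {0..\<rho> / B} \<Longrightarrow> Z s \<in> K"
    "\<And>s. s \<in> {0..\<rho> / B} \<Longrightarrow> Z s \<in> cball z0 \<rho>"
    "\<And>q c \<epsilon> s1 s2. 0 \<le> s1 \<Longrightarrow> s1 \<le> s2 \<Longrightarrow> s2 \<le> \<rho> / B \<Longrightarrow> 0 < \<epsilon> \<Longrightarrow>
       (\<And>s y \<epsilon>' f. s \<in> {s1..s2} \<Longrightarrow> y \<in> K \<Longrightarrow> dist y (Z s) < \<epsilon> \<Longrightarrow> 0 < \<epsilon>' \<Longrightarrow> \<epsilon>' < \<epsilon> \<Longrightarrow> P \<epsilon>' y f \<Longrightarrow> inner q f \<le> c) \<Longrightarrow>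
       inner q (Z s2 - Z s1) \<le> c * (s2 - s1)"
proof -
  \<comment> \<open>Up to this time a curve of speed at most \<open>B\<close> stays in the ball of
    radius \<rho>. The step length \<open>h n\<close> also serves as the aiming tolerance.\<close>
  define S where "S = \<rho> / B"
  have S: "0 < S" using \<rho> B by (simp add: S_def)
  define h where "h n = S / real (Suc n)" for n
  have h: "0 < h n" and Nh: "real (Suc n) * h n = S" for n
    using S by (simp_all add: h_def field_simps)
  define \<eta> where "\<eta> n = sqrt (S * h n * (2 + B\<^sup>2)) + B * h n" for n
  have h_lim: "h \<longlonglongrightarrow> 0"
    using tendsto_mult[OF tendsto_const[of S] LIMSEQ_inverse_real_of_nat]
    by (simp add: h_def[abs_def] divide_inverse)
  have "\<eta> \<longlonglongrightarrow> sqrt (S * 0 * (2 + B\<^sup>2)) + B * 0"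
    unfolding \<eta>_def[abs_def] by (intro tendsto_intros h_lim)
  then have \<eta>_lim: "\<eta> \<longlonglongrightarrow> 0" by simp
  define good where "good n Z \<longleftrightarrow> Z 0 = z0 \<and> (\<forall>s1 s2. 0 \<le> s1 \<longrightarrow> s1 \<le> s2 \<longrightarrow> s2 \<le> S \<longrightarrow> norm (Z s2 - Z s1) \<le> B * (s2 - s1)) \<and>
    (\<forall>s\<in>{0..S}. infdist (Z s) K \<le> \<eta> n) \<and>
    (\<forall>q c s1 s2. 0 \<le> s1 \<longrightarrow> s1 \<le> s2 \<longrightarrow> s2 \<le> S \<longrightarrow>
       (\<forall>s y f. s \<in> {s1..s2} \<longrightarrow> y \<in> K \<longrightarrow> dist y (Z s) \<le> \<eta> n \<longrightarrow> P (h n) y f \<longrightarrow> inner q f \<le> c) \<longrightarrow>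
       inner q (Z s2 - Z s1) \<le> c * (s2 - s1))" for n Z
  have "\<exists>Z. good n Z" for n
  proof -
    have "real (Suc n) * h n * B \<le> \<rho>" unfolding Nh using B by (simp add: S_def)
    from euler_polygon_proximal_aiming[OF K B h this aim[OF h] refl]
    obtain Z where Z: "Z 0 = z0"
      "\<And>s1 s2. 0 \<le> s1 \<Longrightarrow> s1 \<le> s2 \<Longrightarrow> s2 \<le> S \<Longrightarrow> norm (Z s2 - Z s1) \<le> B * (s2 - s1)"
      "\<And>s. s \<in> {0..S} \<Longrightarrow> infdist (Z s) K \<le> \<eta> n"
      "\<And>q c s1 s2. 0 \<le> s1 \<Longrightarrow> s1 \<le> s2 \<Longrightarrow> s2 \<le> S \<Longrightarrow>
       (\<And>s y f. s \<in> {s1..s2} \<Longrightarrow> y \<in> K \<Longrightarrow> dist y (Z s) \<le> \<eta> n \<Longrightarrow> P (h n) y f \<Longrightarrow> inner q f \<le> c) \<Longrightarrow>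
       inner q (Z s2 - Z s1) \<le> c * (s2 - s1)"
      unfolding Nh \<eta>_def by blast
    show ?thesis
      unfolding good_def by (intro exI[of _ Z] conjI allI impI ballI Z) (auto intro: Z)
  qed
  then obtain Z where "\<And>n. good n (Z n)" by metis
  then have Z0: "\<And>n. Z n 0 = z0"
    and lip: "\<And>n s1 s2. 0 \<le> s1 \<Longrightarrow> s1 \<le> s2 \<Longrightarrow> s2 \<le> S \<Longrightarrow> norm (Z n s2 - Z n s1) \<le> B * (s2 - s1)"
    and infd: "\<And>n s. s \<in> {0..S} \<Longrightarrow> infdist (Z n s) K \<le> \<eta> n"
    and incr: "\<And>n q c s1 s2. 0 \<le> s1 \<Longrightarrow> s1 \<le> s2 \<Longrightarrow> s2 \<le> S \<Longrightarrow>
       (\<And>s y f. s \<in> {s1..s2} \<Longrightarrow> y \<in> K \<Longrightarrow> dist y (Z n s) \<le> \<eta> n \<Longrightarrow> P (h n) y f \<Longrightarrow> inner q f \<le> c) \<Longrightarrow>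
       inner q (Z n s2 - Z n s1) \<le> c * (s2 - s1)"
    unfolding good_def by blast+
  have lip': "norm (Z n s - Z n s') \<le> B * \<bar>s - s'\<bar>" if "s \<in> {0..S}" "s' \<in> {0..S}" for n s s'
    using lip[of s s' n] lip[of s' s n] that by (cases "s \<le> s'") (auto simp: norm_minus_commute)
  have ball: "norm (Z n s - z0) \<le> \<rho>" if s: "s \<in> {0..S}" for n s
  proof -
    have "norm (Z n s - z0) \<le> B * s" using lip[of 0 s n] s Z0 by simp
    also have "\<dots> \<le> B * S" using s B by simp
    finally show ?thesis using B by (simp add: S_def)
  qed
  have bnd: "norm (Z n s) \<le> norm z0 + \<rho>" if "s \<in> {0..S}" for n s
    using ball[OF that, of n] norm_triangle_sub[of "Z n s" z0] by linarith
  obtain Y k where Y: "continuous_on {0..S} Y" "strict_mono (k :: nat \<Rightarrow> nat)"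
    "\<And>e. 0 < e \<Longrightarrow> \<exists>N. \<forall>n x. n \<ge> N \<and> x \<in> {0..S} \<longrightarrow> norm (Z (k n) x - Y x) < e"
  proof (rule Arzela_Ascoli[of "{0..S}" Z "norm z0 + \<rho>"])
    fix s e :: real
    assume s: "s \<in> {0..S}" and e: "0 < e"
    show "\<exists>d. 0 < d \<and> (\<forall>n y. y \<in> {0..S} \<and> norm (s - y) < d \<longrightarrow> norm (Z n s - Z n y) < e)"
    proof (intro exI[of _ "e / B"] conjI allI impI)
      show "0 < e / B" using e B by simp
      fix n y assume y: "y \<in> {0..S} \<and> norm (s - y) < e / B"
      then have "B * \<bar>s - y\<bar> < e" using B by (simp add: field_simps)
      with lip'[OF s, of y n] y show "norm (Z n s - Z n y) < e" by simp
    qed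
  qed (use bnd in auto)
  have ptw: "(\<lambda>n. Z (k n) s) \<longlonglongrightarrow> Y s" if "s \<in> {0..S}" for s
    unfolding LIMSEQ_def dist_norm using Y(3) that by meson
  have hk: "(\<lambda>n. h (k n)) \<longlonglongrightarrow> 0" and \<eta>k: "(\<lambda>n. \<eta> (k n)) \<longlonglongrightarrow> 0"
    using LIMSEQ_subseq_LIMSEQ[OF h_lim Y(2)] LIMSEQ_subseq_LIMSEQ[OF \<eta>_lim Y(2)] by (simp_all add: o_def)
  show thesis
  proof (rule that[of Y], unfold S_def[symmetric])
    show "Y 0 = z0" using ptw[of 0] S by (simp add: Z0 LIMSEQ_const_iff)
    show "continuous_on {0..S} Y" by fact
    show "Y s \<in> K" if s: "s \<in> {0..S}" for s
    proof -
      have "(\<lambda>n. infdist (Z (k n) s) K) \<longlonglongrightarrow> infdist (Y s) K"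
        by (intro tendsto_infdist ptw s)
      then have "infdist (Y s) K \<le> 0"
        by (rule LIMSEQ_le[OF _ \<eta>k]) (use infd[OF s] in auto)
      then have "infdist (Y s) K = 0" using infdist_nonneg[of "Y s" K] by linarith
      then show ?thesis using in_closed_iff_infdist_zero[OF K(1)] K(2) by auto
    qed
    show "Y s \<in> cball z0 \<rho>" if s: "s \<in> {0..S}" for s
      by (rule closed_sequentially[OF closed_cball _ ptw[OF s]])
         (use ball[OF s] in \<open>simp add: dist_norm norm_minus_commute\<close>)
    show "inner q (Y s2 - Y s1) \<le> c * (s2 - s1)"
      if s: "0 \<le> s1" "s1 \<le> s2" "s2 \<le> S" and \<epsilon>: "0 < \<epsilon>"
        and q: "\<And>s y \<epsilon>' f. s \<in> {s1..s2} \<Longrightarrow> y \<in> K \<Longrightarrow> dist y (Y s) < \<epsilon> \<Longrightarrow> 0 < \<epsilon>' \<Longrightarrow> \<epsilon>' < \<epsilon> \<Longrightarrow>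
          P \<epsilon>' y f \<Longrightarrow> inner q f \<le> c"
      for q c \<epsilon> s1 s2
    proof (rule tendsto_upperbound)
      show "(\<lambda>n. inner q (Z (k n) s2 - Z (k n) s1)) \<longlonglongrightarrow> inner q (Y s2 - Y s1)"
        using s by (intro tendsto_intros ptw) auto
      \<comment> \<open>Half of \<epsilon> pays for the distance between polygon and limit, the
        other half for the distance \<eta> between polygon and the points of
        \<open>K\<close>.\<close>
      obtain N where N: "\<And>n x. n \<ge> N \<Longrightarrow> x \<in> {0..S} \<Longrightarrow> norm (Z (k n) x - Y x) < \<epsilon> / 2"
        using Y(3)[of "\<epsilon> / 2"] \<epsilon> by auto
      have "\<forall>\<^sub>F n in sequentially. h (k n) < \<epsilon>" "\<forall>\<^sub>F n in sequentially. \<eta> (k n) < \<epsilon> / 2"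
        using order_tendstoD(2)[OF hk \<epsilon>] order_tendstoD(2)[OF \<eta>k half_gt_zero[OF \<epsilon>]] .
      moreover have "\<forall>\<^sub>F n in sequentially. n \<ge> N" by (rule eventually_ge_at_top)
      ultimately show "\<forall>\<^sub>F n in sequentially. inner q (Z (k n) s2 - Z (k n) s1) \<le> c * (s2 - s1)"
      proof eventually_elim
        case (elim n)
        show ?case
        proof (rule incr[OF s])
          fix u y f
          assume u: "u \<in> {s1..s2}" and y: "y \<in> K" "dist y (Z (k n) u) \<le> \<eta> (k n)" "P (h (k n)) y f"
          have "norm (Z (k n) u - Y u) < \<epsilon> / 2" using N elim u s by auto
          then have "dist y (Y u) < \<epsilon>"
            using y(2) elim dist_triangle[of y "Y u" "Z (k n) u"] by (simp add: dist_norm)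
          then show "inner q f \<le> c" using q u y elim h by blast
        qed
      qed
    qed simp
  qed
qed

subsection \<open>Lower semicontinuous Lagrangians\<close>

lemma lsc_on_sequentially:
  assumes lsc: "lsc_on S f" and z: "z \<in> S" and zn: "\<And>n. zn n \<in> S" "zn \<longlonglongrightarrow> z"
    and le: "\<forall>\<^sub>F n in sequentially. f (zn n) \<le> ereal (cn n)" and cn: "cn \<longlonglongrightarrow> c"
  shows "f z \<le> ereal c"
proof (rule ccontr)
  assume "\<not> f z \<le> ereal c"
  then obtain d where d: "ereal c < ereal d" "ereal d < f z"
    using ereal_dense2[of "ereal c" "f z"] by (auto simp: not_le)
  then have "ereal d < Liminf (at z within S) f"
    using lsc z by (auto simp: lsc_on_def intro: less_le_trans)
  then have "\<forall>\<^sub>F y in at z within S. ereal d < f y" by (rule less_LiminfD)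
  then obtain A where A: "open A" "z \<in> A" "\<And>y. y \<in> A \<Longrightarrow> y \<noteq> z \<Longrightarrow> y \<in> S \<Longrightarrow> ereal d < f y"
    unfolding eventually_at_topological by blast
  have "\<forall>\<^sub>F n in sequentially. zn n \<in> A"
    using zn(2) A by (simp add: topological_tendstoD)
  moreover have "\<forall>\<^sub>F n in sequentially. cn n < d"
    using cn d by (intro order_tendstoD(2)) auto
  ultimately have "\<forall>\<^sub>F n in sequentially. False"
    using le
  proof eventually_elim
    case (elim n)
    \<comment> \<open>The lower limit at \<open>z\<close> ignores the value at \<open>z\<close>;
      terms with \<open>zn n = z\<close> are covered by \<open>d < f z\<close>.\<close>
    then have "ereal d < f (zn n)" using A(3) zn(1) d by metis
    with elim show False by (metis less_ereal.simps(1) less_le_trans order.asym)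
  qed
  then show False by simp
qed

text \<open>A real upper bound on \<open>U\<close> forces the time into the closed interval, so
  limits stay where lower semicontinuity applies.\<close>

lemma closed_epi_space_time:
  fixes U :: "real \<Rightarrow> 'a::metric_space \<Rightarrow> ereal"
  assumes lsc: "lsc_on ({a..b} \<times> UNIV) (\<lambda>(t, x). U t x)" and out: "\<And>t x. t \<notin> {a..b} \<Longrightarrow> U t x = \<infinity>"
  shows "closed {(t, x, u). U t x \<le> ereal u}"
  unfolding closed_sequential_limits
proof (intro allI impI, elim conjE)
  fix zn :: "nat \<Rightarrow> real \<times> 'a \<times> real" and z
  assume zn: "\<forall>n. zn n \<in> {(t, x, u). U t x \<le> ereal u}" "zn \<longlonglongrightarrow> z"
  obtain t x u where z: "z = (t, x, u)" by (cases z) auto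
  define tn xn un where "tn n = fst (zn n)" and "xn n = fst (snd (zn n))" and "un n = snd (snd (zn n))" for n
  have lim: "tn \<longlonglongrightarrow> t" "xn \<longlonglongrightarrow> x" "un \<longlonglongrightarrow> u"
    using tendsto_fst[OF zn(2)] tendsto_fst[OF tendsto_snd[OF zn(2)]] tendsto_snd[OF tendsto_snd[OF zn(2)]]
    by (simp_all add: z tn_def[abs_def] xn_def[abs_def] un_def[abs_def])
  have le: "U (tn n) (xn n) \<le> ereal (un n)" for n
    using zn(1) by (auto simp: tn_def xn_def un_def split: prod.splits)
  then have tn: "tn n \<in> {a..b}" for n
    using out by (metis ereal_infty_less_eq(1) PInfty_neq_ereal(1))
  then have "t \<in> {a..b}" using closed_sequentially[OF closed_atLeastAtMost] lim(1) by blast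
  then have "(\<lambda>(t, x). U t x) (t, x) \<le> ereal u"
    by (intro lsc_on_sequentially[OF lsc, of _ "\<lambda>n. (tn n, xn n)" un] tendsto_Pair lim)
       (use tn le in auto)
  then show "z \<in> {(t, x, u). U t x \<le> ereal u}" by (simp add: z)
qed

text \<open>Points with values below \<open>- n\<close> have velocities in a fixed ball, so they
  accumulate at some point of a compact set. Lower semicontinuity would give the value minus
  infinity there.\<close>

lemma lagrangian_bounded_below:
  fixes L :: "real \<Rightarrow> 'a::euclidean_space \<Rightarrow> 'a \<Rightarrow> ereal"
  assumes lsc: "lsc_on ({0..T} \<times> UNIV \<times> UNIV) (\<lambda>(t, x, v). L t x v)"
    and proper: "\<And>t x v. t \<in> {0..T} \<Longrightarrow> L t x v \<noteq> -\<infinity>"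
    and bnd: "\<And>t x v. t \<in> {0..T} \<Longrightarrow> norm x \<le> R \<Longrightarrow> C < norm v \<Longrightarrow> L t x v = \<infinity>"
  obtains M where "0 \<le> M" "\<And>t x v. t \<in> {0..T} \<Longrightarrow> norm x \<le> R \<Longrightarrow> ereal (- M) \<le> L t x v"
proof (rule ccontr)
  assume "\<not> thesis"
  with that have "\<exists>t x v. t \<in> {0..T} \<and> norm x \<le> R \<and> L t x v < ereal (- real n)" for n
    by (meson of_nat_0_le_iff not_le)
  then obtain tn xn vn where n: "\<And>n. tn n \<in> {0..T}" "\<And>n. norm (xn n) \<le> R"
    "\<And>n. L (tn n) (xn n) (vn n) < ereal (- real n)"
    by metis
  have "norm (vn n) \<le> C" for n
    using bnd[OF n(1,2), of "vn n"] n(3)[of n] by (metis less_ereal.simps(2) not_le)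
  then have "\<forall>n. (tn n, xn n, vn n) \<in> {0..T} \<times> cball 0 R \<times> cball 0 C"
    using n by auto
  moreover have "compact ({0..T} \<times> cball (0::'a) R \<times> cball (0::'a) C)"
    by (intro compact_Times) auto
  ultimately obtain z k where z: "z \<in> {0..T} \<times> cball 0 R \<times> cball 0 C" "strict_mono (k :: nat \<Rightarrow> nat)"
    "((\<lambda>n. (tn n, xn n, vn n)) \<circ> k) \<longlonglongrightarrow> z"
    unfolding compact_def by meson
  have "(\<lambda>(t, x, v). L t x v) z \<le> ereal (- m)" for m
  proof (rule lsc_on_sequentially[OF lsc _ _ z(3)])
    obtain N where N: "m \<le> real N" using real_arch_simple by blast
    have "L (tn (k n)) (xn (k n)) (vn (k n)) \<le> ereal (- m)" if "N \<le> n" for n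
    proof -
      have "real N \<le> real (k n)" using seq_suble[OF z(2), of n] that by simp
      with N have "ereal (- real (k n)) \<le> ereal (- m)" by simp
      with n(3)[of "k n"] show ?thesis by (meson less_imp_le order_trans)
    qed
    then show "\<forall>\<^sub>F n in sequentially. (\<lambda>(t, x, v). L t x v) (((\<lambda>n. (tn n, xn n, vn n)) \<circ> k) n) \<le> ereal (- m)"
      by (auto simp: eventually_sequentially)
  qed (use z n in auto)
  then have "(\<lambda>(t, x, v). L t x v) z = -\<infinity>"
    by (metis ereal_bot minus_minus)
  with proper z(1) show False by auto
qed

text \<open>Violations at points tending to \<open>(\<tau>, \<xi>)\<close> have bounded velocities
  and hence a limit velocity. Lower semicontinuity yields a non-strict violation at
  \<open>(\<tau>, \<xi>)\<close>, which strictness of the minorant excludes.\<close>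

lemma affine_minorant_persists:
  fixes L :: "real \<Rightarrow> 'a::euclidean_space \<Rightarrow> 'a \<Rightarrow> ereal"
  assumes lsc: "lsc_on ({0..T} \<times> UNIV \<times> UNIV) (\<lambda>(t, x, v). L t x v)"
    and bnd: "\<And>R. \<exists>C\<ge>0. \<forall>t x v. t \<in> {0..T} \<and> norm x \<le> R \<and> norm v > C \<longrightarrow> L t x v = \<infinity>"
    and \<tau>: "\<tau> \<in> {0..T}" and minorant: "\<And>v. ereal (inner p v - c) < L \<tau> \<xi> v"
  obtains r where "0 < r"
    "\<And>t x v. t \<in> {0..T} \<Longrightarrow> dist t \<tau> < r \<Longrightarrow> dist x \<xi> < r \<Longrightarrow> ereal (inner p v - c) \<le> L t x v"
proof (rule ccontr)
  assume "\<not> thesis"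
  with that have "\<exists>t x v. t \<in> {0..T} \<and> dist t \<tau> < inverse (real (Suc n)) \<and> dist x \<xi> < inverse (real (Suc n)) \<and>
      L t x v < ereal (inner p v - c)" for n
    by (meson inverse_positive_iff_positive of_nat_0_less_iff zero_less_Suc not_le)
  then obtain tn xn vn where n: "\<And>n. tn n \<in> {0..T}" "\<And>n. dist (tn n) \<tau> < inverse (real (Suc n))"
    "\<And>n. dist (xn n) \<xi> < inverse (real (Suc n))" "\<And>n. L (tn n) (xn n) (vn n) < ereal (inner p (vn n) - c)"
    by metis
  have tn: "tn \<longlonglongrightarrow> \<tau>"
    by (rule tendsto_dist_iff[THEN iffD2], rule Lim_null_comparison[OF _ LIMSEQ_inverse_real_of_nat])
       (use less_imp_le[OF n(2)] in simp)
  have xn: "xn \<longlonglongrightarrow> \<xi>"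
    by (rule tendsto_dist_iff[THEN iffD2], rule Lim_null_comparison[OF _ LIMSEQ_inverse_real_of_nat])
       (use less_imp_le[OF n(3)] in simp)
  have xb: "norm (xn n) \<le> norm \<xi> + 1" for n
  proof -
    have "inverse (real (Suc n)) \<le> 1" by (simp add: inverse_le_1_iff)
    then show ?thesis using n(3)[of n] norm_triangle_sub[of "xn n" \<xi>] by (simp add: dist_norm)
  qed
  obtain C where C: "\<And>t x v. t \<in> {0..T} \<Longrightarrow> norm x \<le> norm \<xi> + 1 \<Longrightarrow> C < norm v \<Longrightarrow> L t x v = \<infinity>"
    using bnd[of "norm \<xi> + 1"] by blast
  have "norm (vn n) \<le> C" for n
    using C[OF n(1)[of n] xb[of n], of "vn n"] n(4)[of n] by (metis less_ereal.simps(2) not_le)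
  then have "bounded (range vn)" by (auto simp: bounded_iff)
  then obtain v k where k: "strict_mono (k :: nat \<Rightarrow> nat)" "(vn \<circ> k) \<longlonglongrightarrow> v"
    using bounded_imp_convergent_subsequence by blast
  have "(\<lambda>(t, x, v). L t x v) (\<tau>, \<xi>, v) \<le> ereal (inner p v - c)"
  proof (rule lsc_on_sequentially[OF lsc, where zn = "\<lambda>n. (tn (k n), xn (k n), vn (k n))"])
    show "(\<lambda>n. (tn (k n), xn (k n), vn (k n))) \<longlonglongrightarrow> (\<tau>, \<xi>, v)"
      using LIMSEQ_subseq_LIMSEQ[OF tn k(1)] LIMSEQ_subseq_LIMSEQ[OF xn k(1)] k(2)
      by (intro tendsto_Pair) (simp_all add: o_def)
    show "(\<lambda>n. inner p (vn (k n)) - c) \<longlonglongrightarrow> inner p v - c"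
      using k(2) by (intro tendsto_intros) (simp add: o_def)
  qed (use n \<tau> less_imp_le[OF n(4)] in auto)
  with minorant[of v] show False by simp
qed

text \<open>A hyperplane separates \<open>(y, w)\<close> from the closed convex epigraph. If it is
  not vertical, it is the graph of a strict affine minorant exceeding \<open>w\<close> at
  \<open>y\<close>. If it is vertical, a large multiple of it added to the constant
  \<open>- M - 1\<close> is such a minorant.\<close>

lemma le_of_affine_minorants:
  fixes f :: "'a::euclidean_space \<Rightarrow> ereal"
  assumes cvx: "econvex f" and cl: "closed (epi f)" and v0: "f v0 \<noteq> \<infinity>" and M: "\<And>v. ereal (- M) \<le> f v"
    and le: "\<And>p c. (\<And>v. ereal (inner p v - c) < f v) \<Longrightarrow> inner p y - c \<le> w"
  shows "f y \<le> ereal w"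
proof (rule ccontr)
  assume "\<not> f y \<le> ereal w"
  then have "(y, w) \<notin> epi f" by (simp add: epi_def)
  with cvx cl obtain a b where ab: "inner a (y, w) < b" "\<And>z. z \<in> epi f \<Longrightarrow> b < inner a z"
    using separating_hyperplane_closed_point[of "epi f" "(y, w)"] unfolding econvex_def by blast
  obtain p q where a: "a = (p, q)" by fastforce
  have sep: "b < inner p v + q * r" if "f v \<le> ereal r" for v r
    using ab(2)[of "(v, r)"] that by (simp add: epi_def a)
  have yw: "inner p y + q * w < b" using ab(1) by (simp add: a)
  have fin: "f v = \<infinity> \<or> (\<exists>r. f v = ereal r \<and> - M \<le> r)" for v
    using M[of v] by (cases "f v") auto
  obtain r0 where r0: "f v0 = ereal r0" using fin[of v0] v0 by auto
  have "0 \<le> q"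
  proof (rule ccontr)
    assume q: "\<not> 0 \<le> q"
    \<comment> \<open>The epigraph contains the vertical ray above \<open>(v0, r0)\<close>. With
      \<open>q < 0\<close>, raising the point by \<open>k\<close> breaks the separating
      inequality.\<close>
    define k where "k = max 0 ((inner p v0 + q * r0 - b) / (- q))"
    have "b < inner p v0 + q * (r0 + k)"
      by (rule sep) (simp add: r0 k_def)
    moreover have "inner p v0 + q * r0 - b \<le> (- q) * k"
      using q by (simp add: k_def field_simps max_def)
    ultimately show False by (simp add: algebra_simps)
  qed
  then consider "0 < q" | "q = 0" by linarith
  then show False
  proof cases
    case 1
    have "inner (- (p /\<^sub>R q)) y - (- b / q) \<le> w"
    proof (rule le)
      fix v
      show "ereal (inner (- (p /\<^sub>R q)) v - - b / q) < f v"
        using fin[of v]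
      proof
        assume "\<exists>r. f v = ereal r \<and> - M \<le> r"
        then obtain r where r: "f v = ereal r" by blast
        with sep[of v r] 1 show ?thesis by (simp add: field_simps)
      qed simp
    qed
    with yw 1 show False by (simp add: field_simps)
  next
    case 2
    \<comment> \<open>With this slope the minorant takes the value
      \<open>\<bar>w\<bar> + \<bar>M\<bar> + 2 - M - 1\<close> at \<open>y\<close>, which exceeds
      \<open>w\<close>.\<close>
    define l where "l = (\<bar>w\<bar> + \<bar>M\<bar> + 2) / (b - inner p y)"
    have by_pos: "0 < b - inner p y" using yw 2 by simp
    then have l: "0 \<le> l" by (simp add: l_def)
    have "inner (- (l *\<^sub>R p)) y - (- (l * b - M - 1)) \<le> w"
    proof (rule le)
      fix v
      show "ereal (inner (- (l *\<^sub>R p)) v - - (l * b - M - 1)) < f v"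
        using fin[of v]
      proof
        assume "\<exists>r. f v = ereal r \<and> - M \<le> r"
        then obtain r where r: "f v = ereal r" "- M \<le> r" by blast
        then have "b - inner p v \<le> 0" using sep[of v r] 2 by simp
        then have "l * (b - inner p v) \<le> 0" using l by (simp add: mult_nonneg_nonpos)
        with r show ?thesis by (simp add: algebra_simps)
      qed simp
    qed
    then have "l * (b - inner p y) - M - 1 \<le> w" by (simp add: algebra_simps)
    moreover have "l * (b - inner p y) = \<bar>w\<bar> + \<bar>M\<bar> + 2" using by_pos by (simp add: l_def)
    ultimately show False by linarith
  qed
qed

lemma closed_epi_lagrangian:
  fixes L :: "real \<Rightarrow> 'a::euclidean_space \<Rightarrow> 'a \<Rightarrow> ereal"
  assumes lsc: "lsc_on ({0..T} \<times> UNIV \<times> UNIV) (\<lambda>(t, x, v). L t x v)" and t: "t \<in> {0..T}"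
  shows "closed (epi (L t x))"
  unfolding closed_sequential_limits
proof (intro allI impI, elim conjE)
  fix zn :: "nat \<Rightarrow> 'a \<times> real" and z
  assume zn: "\<forall>n. zn n \<in> epi (L t x)" "zn \<longlonglongrightarrow> z"
  have "(\<lambda>(t, x, v). L t x v) (t, x, fst z) \<le> ereal (snd z)"
    using zn(2) by (intro lsc_on_sequentially[OF lsc, of _ "\<lambda>n. (t, x, fst (zn n))" "\<lambda>n. snd (zn n)"] tendsto_intros)
      (use zn(1) t in \<open>auto simp: epi_def case_prod_beta\<close>)
  then show "z \<in> epi (L t x)" by (auto simp: epi_def case_prod_beta)
qed

subsection \<open>The reparametrised trajectory\<close>

lemma normalised_velocity:
  fixes l :: real
  defines "a \<equiv> 1 / (1 + \<bar>l\<bar>)"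
  shows "0 < a" "a \<le> 1" "a * (1 + \<bar>l\<bar>) = 1"
  by (simp_all add: a_def add_pos_nonneg) 

text \<open>Viability is applied to the epigraph with velocities \<open>(1, v, - l)\<close> divided
  by \<open>1 + \<bar>l\<bar>\<close>, and the time component of the resulting curve is then
  inverted. The last conclusion is what remains of the dynamics:
  \<open>inner p v - c \<le> l\<close> bounds \<open>inner p v - l\<close> by \<open>c\<close>, and
  this is integrated over a short interval ending at \<open>t\<close>.\<close>

lemma reparametrised_trajectory:
  fixes T :: real
    and L :: "real \<Rightarrow> 'a::euclidean_space \<Rightarrow> 'a \<Rightarrow> ereal"
    and U :: "real \<Rightarrow> 'a \<Rightarrow> ereal"
  assumes L_lsc: "lsc_on ({0..T} \<times> UNIV \<times> UNIV) (\<lambda>(t, x, v). L t x v)"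
    and L_proper: "\<And>t x v. t \<in> {0..T} \<Longrightarrow> L t x v \<noteq> -\<infinity>"
    and L_bounded: "\<And>R. \<exists>C\<ge>0. \<forall>t x v. t \<in> {0..T} \<and> norm x \<le> R \<and> norm v > C \<longrightarrow> L t x v = \<infinity>"
    and U_lsc: "lsc_on ({0..T} \<times> UNIV) (\<lambda>(t, x). U t x)"
    and U_outside: "\<And>t x. t \<notin> {0..T} \<Longrightarrow> U t x = \<infinity>"
    and normal_cond:
      "\<And>t x u nt nx nu.
         ((t, x), u) \<in> epi (\<lambda>(t, x). U t x) \<Longrightarrow> 0 \<le> t \<Longrightarrow> t < T \<Longrightarrow>
         (nt, nx, nu) \<in> normal_cone {(t', x', u'). ((t', x'), u') \<in> epi (\<lambda>(t, x). U t x)} (t, x, u) \<Longrightarrow>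
         \<exists>tk xk \<alpha> vk. (\<forall>k. tk k \<in> {0..T}) \<and> tk \<longlonglongrightarrow> t \<and> xk \<longlonglongrightarrow> x \<and> \<alpha> \<longlonglongrightarrow> 0 \<and>
            (\<forall>k. vk k \<in> edom (L (tk k) (xk k)) \<and>
                 nt + inner (vk k) nx - nu * real_of_ereal (L (tk k) (xk k) (vk k)) \<le> \<alpha> k)"
    and init: "U t0 x0 = ereal u0" "t0 < T"
  obtains T1 M X W C where "t0 < T1" "T1 < T" "0 \<le> M" "X t0 = x0" "W t0 = u0"
    "C-lipschitz_on {t0..T1} X"
    "\<And>t. t \<in> {t0..T1} \<Longrightarrow> U t (X t) \<le> ereal (W t)"
    "\<And>t v. t \<in> {t0..T1} \<Longrightarrow> ereal (- M) \<le> L t (X t) v"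
    "\<And>t t'. t' \<in> {t0..T1} \<Longrightarrow> t \<in> {t0..T1} \<Longrightarrow> t' \<le> t \<Longrightarrow> W t - W t' \<le> M * (t - t')"
    "\<And>t p c r. t \<in> {t0..T1} \<Longrightarrow> 0 < r \<Longrightarrow>
       (\<And>t' x v. t' \<in> {0..T} \<Longrightarrow> dist t' t < r \<Longrightarrow> dist x (X t) < r \<Longrightarrow> ereal (inner p v - c) \<le> L t' x v) \<Longrightarrow>
       \<exists>\<delta>>0. \<forall>t'\<in>{t0..t}. t - t' < \<delta> \<longrightarrow> inner p (X t - X t') + (W t - W t') \<le> c * (t - t')"
proof -

  \<comment> \<open>The epigraph, the constants and the aiming condition\<close>
  define R where "R = norm x0 + 2"
  obtain C where C: "0 \<le> C" "\<And>t x v. t \<in> {0..T} \<Longrightarrow> norm x \<le> R \<Longrightarrow> C < norm v \<Longrightarrow> L t x v = \<infinity>"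
    using L_bounded[of R] by blast
  obtain M where M: "0 \<le> M" "\<And>t x v. t \<in> {0..T} \<Longrightarrow> norm x \<le> R \<Longrightarrow> ereal (- M) \<le> L t x v"
    using lagrangian_bounded_below[OF L_lsc L_proper C(2)] by blast
  define K where "K = {(t, x, u). U t x \<le> ereal u}"
  have K_eq: "{(t', x', u'). ((t', x'), u') \<in> epi (\<lambda>(t, x). U t x)} = K"
    by (simp add: K_def epi_def)
  have K_closed: "closed K"
    unfolding K_def by (rule closed_epi_space_time[OF U_lsc U_outside])
  have K_time: "t \<in> {0..T}" if "(t, x, u) \<in> K" for t x u
    using that U_outside[of t x] by (cases "t \<in> {0..T}") (auto simp: K_def)
  define z0 where "z0 = (t0, x0, u0)"
  have z0: "z0 \<in> K" using init by (simp add: K_def z0_def)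
  \<comment> \<open>A closest point of a point in the \<rho>-ball is within
    \<open>2 * \<rho>\<close> of \<open>z0\<close>. So its time stays below \<open>T\<close> and its
    space component within 1 of \<open>x0\<close>; the approximating \<open>xk\<close> may add
    another 1, which explains the 2 in \<open>R\<close>.\<close>
  define \<rho> where "\<rho> = min (1 / 2) ((T - t0) / 4)"
  have \<rho>: "0 < \<rho>" "\<rho> \<le> 1 / 2" "4 * \<rho> \<le> T - t0" using init by (auto simp: \<rho>_def min_def)
  define B where "B = 1 + C"
  have B: "0 < B" using C by (simp add: B_def)
  define P where "P = (\<lambda>\<epsilon> (y :: real \<times> 'a \<times> real) (f :: real \<times> 'a \<times> real). \<exists>t x v l. t \<in> {0..T} \<and> norm x \<le> R \<and>
      dist t (fst y) < \<epsilon> \<and> dist x (fst (snd y)) < \<epsilon> \<and> L t x v = ereal l \<and>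
      f = (1 / (1 + \<bar>l\<bar>)) *\<^sub>R (1, v, - l))"
  have vC: "norm v \<le> C" if "t \<in> {0..T}" "norm x \<le> R" "L t x v = ereal l" for t x v l
    using C(2)[OF that(1,2), of v] that(3) by (metis PInfty_neq_ereal(1) not_le)
  have aim: "\<exists>f. P \<epsilon> s f \<and> norm f \<le> B \<and> inner f (z - s) \<le> \<epsilon>"
    if \<epsilon>: "0 < \<epsilon>" and z: "z \<in> cball z0 \<rho>" and s: "s \<in> K" and dist_s: "dist z s = infdist z K" for \<epsilon> z s
  proof -
    obtain ts xs us where s_eq: "s = (ts, xs, us)" by (cases s) auto
    obtain nt nx nu where n_eq: "z - s = (nt, nx, nu)" by (cases "z - s") auto
    have "dist z s \<le> \<rho>"
      using infdist_le[OF z0, of z] dist_s z by (simp add: dist_commute)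
    then have d: "dist s z0 \<le> 2 * \<rho>"
      using z dist_triangle[of s z0 z] by (simp add: dist_commute)
    have "dist ts t0 \<le> 2 * \<rho>"
      using d dist_fst_le[of s z0] by (simp add: s_eq z0_def)
    then have ts: "ts < T" using \<rho> by (simp add: dist_real_def)
    have "dist xs x0 \<le> 2 * \<rho>"
      using d dist_snd_le[of s z0] dist_fst_le[of "snd s" "snd z0"] by (simp add: s_eq z0_def)
    then have xs: "dist xs x0 \<le> 1" using \<rho> by simp
    have ts0: "0 \<le> ts" using K_time[of ts xs us] s by (simp add: s_eq)
    have epi_s: "((ts, xs), us) \<in> epi (\<lambda>(t, x). U t x)" using s by (simp add: s_eq K_def epi_def)
    \<comment> \<open>The hypothesis on normals is used at the closest point with the proximal
      normal \<open>z - s\<close>; its inequality is the aiming condition before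
      normalisation.\<close>
    have "(nt, nx, nu) \<in> normal_cone K (ts, xs, us)"
      using proximal_normal_in_normal_cone[OF K_closed s dist_s] unfolding n_eq by (simp only: s_eq)
    then obtain tk xk \<alpha> vk where k: "\<forall>k. tk k \<in> {0..T}" "tk \<longlonglongrightarrow> ts" "xk \<longlonglongrightarrow> xs" "\<alpha> \<longlonglongrightarrow> 0"
      "\<forall>k. vk k \<in> edom (L (tk k) (xk k)) \<and>
           nt + inner (vk k) nx - nu * real_of_ereal (L (tk k) (xk k) (vk k)) \<le> \<alpha> k"
      using normal_cond[OF epi_s ts0 ts] unfolding K_eq by blast
    have "\<forall>\<^sub>F k in sequentially. dist (tk k) ts < \<epsilon>" "\<forall>\<^sub>F k in sequentially. dist (xk k) xs < min \<epsilon> 1"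
      "\<forall>\<^sub>F k in sequentially. \<alpha> k < \<epsilon>"
      using k \<epsilon> by (auto intro!: tendstoD order_tendstoD(2)[OF k(4)] simp del: min_less_iff_conj)
    then have "\<forall>\<^sub>F k in sequentially. dist (tk k) ts < \<epsilon> \<and> dist (xk k) xs < min \<epsilon> 1 \<and> \<alpha> k < \<epsilon>"
      by eventually_elim auto
    then obtain k where kk: "dist (tk k) ts < \<epsilon>" "dist (xk k) xs < min \<epsilon> 1" "\<alpha> k < \<epsilon>"
      using eventually_happens'[OF sequentially_bot] by blast
    define l where "l = real_of_ereal (L (tk k) (xk k) (vk k))"
    have l: "L (tk k) (xk k) (vk k) = ereal l"
      using k(5) by (auto simp: l_def edom_def ereal_real)
    define a where "a = 1 / (1 + \<bar>l\<bar>)"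
    note a = normalised_velocity[of l, folded a_def]
    define f where "f = a *\<^sub>R (1 :: real, vk k, - l)"
    have xR: "norm (xk k) \<le> R"
      using kk(2) xs norm_triangle_sub[of "xk k" x0] dist_triangle[of "xk k" x0 xs] by (simp add: R_def dist_norm)
    have "P \<epsilon> s f"
      unfolding P_def
      by (intro exI[of _ "tk k"] exI[of _ "xk k"] exI[of _ "vk k"] exI[of _ l])
         (use kk k(1) l xR in \<open>auto simp: s_eq f_def a_def\<close>)
    moreover have "norm f \<le> B"
    proof -
      have "norm (1 :: real, vk k, - l) \<le> norm (1 :: real) + norm (vk k, - l)" by (rule norm_Pair_le)
      also have "norm (vk k, - l) \<le> norm (vk k) + norm (- l)" by (rule norm_Pair_le)
      also have "norm (vk k) \<le> C" using vC[OF _ xR l] k(1) by blast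
      finally have "norm (1 :: real, vk k, - l) \<le> (1 + \<bar>l\<bar>) + C" by simp
      then have "norm f \<le> a * ((1 + \<bar>l\<bar>) + C)"
        unfolding f_def norm_scaleR using a(1) by (intro mult_mono) auto
      also have "\<dots> = 1 + a * C" using a(3) by (simp add: distrib_left)
      also have "a * C \<le> C" using a C by (intro mult_left_le_one_le) auto
      finally show ?thesis by (simp add: B_def)
    qed
    moreover have "inner f (z - s) \<le> \<epsilon>"
    proof -
      have "inner f (z - s) = a * (nt + inner (vk k) nx - nu * l)"
        by (simp add: f_def n_eq algebra_simps)
      also have "\<dots> \<le> a * \<epsilon>"
        using k(5)[rule_format, of k] kk(3) a(1) unfolding l_def[symmetric] by (intro mult_left_mono) auto
      also have "\<dots> \<le> \<epsilon>" using a \<epsilon> by (intro mult_left_le_one_le) auto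
      finally show ?thesis .
    qed
    ultimately show ?thesis by blast
  qed

  \<comment> \<open>The viable curve and inequalities for its increments\<close>
  define S where "S = \<rho> / B"
  have S: "0 < S" using \<rho> B by (simp add: S_def)
  obtain Z where Z: "Z 0 = z0" "continuous_on {0..S} Z" "\<And>s. s \<in> {0..S} \<Longrightarrow> Z s \<in> K"
    "\<And>s. s \<in> {0..S} \<Longrightarrow> Z s \<in> cball z0 \<rho>"
    and incr: "\<And>q c \<epsilon> s1 s2. 0 \<le> s1 \<Longrightarrow> s1 \<le> s2 \<Longrightarrow> s2 \<le> S \<Longrightarrow> 0 < \<epsilon> \<Longrightarrow>
       (\<And>s y \<epsilon>' f. s \<in> {s1..s2} \<Longrightarrow> y \<in> K \<Longrightarrow> dist y (Z s) < \<epsilon> \<Longrightarrow> 0 < \<epsilon>' \<Longrightarrow> \<epsilon>' < \<epsilon> \<Longrightarrow> P \<epsilon>' y f \<Longrightarrow> inner q f \<le> c) \<Longrightarrow>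
       inner q (Z s2 - Z s1) \<le> c * (s2 - s1)"
    using viability_proximal_aiming[OF K_closed z0 B \<rho>(1) aim] unfolding S_def by blast
  define t x u where "t s = fst (Z s)" and "x s = fst (snd (Z s))" and "u s = snd (snd (Z s))" for s
  have Z_eq: "Z s = (t s, x s, u s)" for s by (simp add: t_def x_def u_def)
  \<comment> \<open>Multiplying by \<open>1 + \<bar>l\<bar>\<close> restates the increment bound for
    velocities that are not normalised. The estimates below are choices of the functional
    \<open>(qt, qx, qu)\<close>.\<close>
  have lin: "qt * (t s2 - t s1) + inner qx (x s2 - x s1) + qu * (u s2 - u s1) \<le> c * (s2 - s1)"
    if s: "0 \<le> s1" "s1 \<le> s2" "s2 \<le> S" and \<epsilon>: "0 < \<epsilon>"
      and q: "\<And>s y t' x' v l. s \<in> {s1..s2} \<Longrightarrow> y \<in> K \<Longrightarrow> dist y (Z s) < \<epsilon> \<Longrightarrow> t' \<in> {0..T} \<Longrightarrow>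
        norm x' \<le> R \<Longrightarrow> dist t' (fst y) < \<epsilon> \<Longrightarrow> dist x' (fst (snd y)) < \<epsilon> \<Longrightarrow> L t' x' v = ereal l \<Longrightarrow>
        qt + inner qx v - qu * l \<le> c * (1 + \<bar>l\<bar>)"
    for qt qx qu c \<epsilon> s1 s2
  proof -
    have "inner (qt, qx, qu) (Z s2 - Z s1) \<le> c * (s2 - s1)"
    proof (rule incr[OF s \<epsilon>])
      fix s y \<epsilon>' f
      assume y: "s \<in> {s1..s2}" "y \<in> K" "dist y (Z s) < \<epsilon>" "0 < \<epsilon>'" "\<epsilon>' < \<epsilon>" and "P \<epsilon>' y f"
      then obtain t' x' v l where l: "t' \<in> {0..T}" "norm x' \<le> R" "dist t' (fst y) < \<epsilon>'"
        "dist x' (fst (snd y)) < \<epsilon>'" "L t' x' v = ereal l" and f: "f = (1 / (1 + \<bar>l\<bar>)) *\<^sub>R (1, v, - l)"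
        unfolding P_def by blast
      have "qt + inner qx v - qu * l \<le> c * (1 + \<bar>l\<bar>)"
        using y l by (intro q[of s y t' x' v l]) auto
      then have "(1 / (1 + \<bar>l\<bar>)) * (qt + inner qx v - qu * l) \<le> (1 / (1 + \<bar>l\<bar>)) * (c * (1 + \<bar>l\<bar>))"
        by (intro mult_left_mono) auto
      also have "\<dots> = c" using normalised_velocity(3)[of l] by (simp add: ac_simps)
      also have "a * (qt + inner qx v - qu * l) = inner (qt, qx, qu) (a *\<^sub>R (1, v, - l))" for a
        by (simp add: algebra_simps)
      finally show "inner (qt, qx, qu) f \<le> c" unfolding f .
    qed
    then show ?thesis by (simp add: Z_eq)
  qed
  have lM: "- M \<le> l" if "t' \<in> {0..T}" "norm x' \<le> R" "L t' x' v = ereal l" for t' x' v l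
    using M(2)[OF that(1,2), of v] that(3) by simp
  have t_mono: "t s1 \<le> t s2" if s: "0 \<le> s1" "s1 \<le> s2" "s2 \<le> S" for s1 s2
    using lin[OF s zero_less_one, of "-1" 0 0 0] by simp
  have x_lip: "norm (x s2 - x s1) \<le> C * (t s2 - t s1)" if s: "0 \<le> s1" "s1 \<le> s2" "s2 \<le> S" for s1 s2
  proof -
    define e where "e = sgn (x s2 - x s1)"
    have e: "norm e \<le> 1" by (simp add: e_def norm_sgn)
    have "- C * (t s2 - t s1) + inner e (x s2 - x s1) + 0 * (u s2 - u s1) \<le> 0 * (s2 - s1)"
    proof (rule lin[OF s zero_less_one])
      fix t' x' v l
      assume "t' \<in> {0..T}" "norm x' \<le> R" "L t' x' v = ereal l"
      then have "norm v \<le> C" by (rule vC)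
      moreover have "inner e v \<le> norm e * norm v" by (rule norm_cauchy_schwarz)
      moreover have "norm e * norm v \<le> norm v" using e by (intro mult_left_le_one_le) auto
      ultimately show "- C + inner e v - 0 * l \<le> 0 * (1 + \<bar>l\<bar>)" by simp
    qed
    moreover have "inner e (x s2 - x s1) = norm (x s2 - x s1)"
      by (cases "x s2 = x s1") (simp_all add: e_def sgn_div_norm dot_square_norm power2_eq_square)
    ultimately show ?thesis by simp
  qed
  have u_le: "u s2 - u s1 \<le> M * (t s2 - t s1)" if s: "0 \<le> s1" "s1 \<le> s2" "s2 \<le> S" for s1 s2
  proof -
    have "- M * (t s2 - t s1) + inner 0 (x s2 - x s1) + 1 * (u s2 - u s1) \<le> 0 * (s2 - s1)"
      by (rule lin[OF s zero_less_one]) (use lM in fastforce)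
    then show ?thesis by simp
  qed
  \<comment> \<open>From \<open>l \<ge> - M\<close> follows
    \<open>1 + \<bar>l\<bar> - l \<le> 1 + 2 * M\<close>: while time stands still, \<open>u\<close>
    decreases at least at unit rate in the parameter.\<close>
  have progress: "u s2 - u s1 + (s2 - s1) \<le> (1 + 2 * M) * (t s2 - t s1)" if s: "0 \<le> s1" "s1 \<le> s2" "s2 \<le> S" for s1 s2
  proof -
    have "- (1 + 2 * M) * (t s2 - t s1) + inner 0 (x s2 - x s1) + 1 * (u s2 - u s1) \<le> - 1 * (s2 - s1)"
    proof (rule lin[OF s zero_less_one])
      fix t' x' v l
      assume "t' \<in> {0..T}" "norm x' \<le> R" "L t' x' v = ereal l"
      then have "- M \<le> l" by (rule lM)
      with M(1) show "- (1 + 2 * M) + inner 0 v - 1 * l \<le> - 1 * (1 + \<bar>l\<bar>)" by simp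
    qed
    then show ?thesis by (simp add: algebra_simps)
  qed
  have at_0: "t 0 = t0" "x 0 = x0" "u 0 = u0" using Z(1) by (simp_all add: t_def x_def u_def z0_def)
  define T1 where "T1 = t S"
  \<comment> \<open>If time did not advance, the state would not move either, and \<open>u\<close>
    would drop below \<open>u0 = U t0 x0\<close>, outside the epigraph.\<close>
  have T1: "t0 < T1"
  proof (rule ccontr)
    assume "\<not> t0 < T1"
    then have tS: "t S = t0" using t_mono[of 0 S] S at_0 by (simp add: T1_def)
    then have "x S = x0" using x_lip[of 0 S] S at_0 by simp
    moreover have "u S < u0" using progress[of 0 S] S at_0 tS by simp
    moreover have "Z S \<in> K" using Z(3) S by simp
    ultimately show False using init tS by (simp add: Z_eq K_def)
  qed
  have near: "dist (t s) t0 \<le> \<rho>" "dist (x s) x0 \<le> \<rho>" if "s \<in> {0..S}" for s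
  proof -
    have d: "dist (Z s) z0 \<le> \<rho>" using Z(4)[OF that] by (simp add: dist_commute)
    show "dist (t s) t0 \<le> \<rho>" using d dist_fst_le[of "Z s" z0] by (simp add: Z_eq z0_def)
    show "dist (x s) x0 \<le> \<rho>"
      using d dist_snd_le[of "Z s" z0] dist_fst_le[of "snd (Z s)" "snd z0"] by (simp add: Z_eq z0_def)
  qed
  have T1_T: "T1 < T" using near(1)[of S] S \<rho> by (simp add: T1_def dist_real_def)
  have "continuous_on {0..S} t"
    unfolding t_def[abs_def] using Z(2) by (intro continuous_intros)

  \<comment> \<open>Parametrisation by time\<close>
  then have "\<exists>s\<in>{0..S}. t s = \<tau>" if "\<tau> \<in> {t0..T1}" for \<tau>
    using IVT'[of t 0 \<tau> S] that S at_0 by (auto simp: T1_def)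
  then obtain \<sigma>' where \<sigma>': "\<And>\<tau>. \<tau> \<in> {t0..T1} \<Longrightarrow> \<sigma>' \<tau> \<in> {0..S} \<and> t (\<sigma>' \<tau>) = \<tau>"
    by metis
  \<comment> \<open>This right inverse of \<open>t\<close> may jump where \<open>t\<close> is
    constant, hence so may \<open>W\<close>, but not \<open>X\<close>. The value 0 at
    \<open>t0\<close> is prescribed in order that \<open>W\<close> starts at
    \<open>u0\<close>.\<close>
  define \<sigma> where "\<sigma> \<tau> = (if \<tau> = t0 then 0 else \<sigma>' \<tau>)" for \<tau>
  have \<sigma>: "0 \<le> \<sigma> \<tau>" "\<sigma> \<tau> \<le> S" "t (\<sigma> \<tau>) = \<tau>" if "\<tau> \<in> {t0..T1}" for \<tau>
    using \<sigma>'[OF that] S at_0 by (auto simp: \<sigma>_def)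
  have \<sigma>_mono: "\<sigma> \<tau>' \<le> \<sigma> \<tau>" if "\<tau>' \<in> {t0..T1}" "\<tau> \<in> {t0..T1}" "\<tau>' \<le> \<tau>" for \<tau> \<tau>'
  proof (rule ccontr)
    assume *: "\<not> \<sigma> \<tau>' \<le> \<sigma> \<tau>"
    then have "t (\<sigma> \<tau>) \<le> t (\<sigma> \<tau>')" using \<sigma> that by (intro t_mono) auto
    with \<sigma> that have "\<tau>' = \<tau>" by auto
    with * show False by simp
  qed
  define X where "X \<tau> = x (\<sigma> \<tau>)" for \<tau>
  define W where "W \<tau> = u (\<sigma> \<tau>)" for \<tau>
  have X_lip: "norm (X \<tau> - X \<tau>') \<le> C * (\<tau> - \<tau>')" if "\<tau>' \<in> {t0..T1}" "\<tau> \<in> {t0..T1}" "\<tau>' \<le> \<tau>" for \<tau> \<tau>'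
    using x_lip[of "\<sigma> \<tau>'" "\<sigma> \<tau>"] \<sigma>_mono[OF that] \<sigma>[OF that(1)] \<sigma>[OF that(2)] by (simp add: X_def)
  show thesis
  proof (rule that[of T1 M X W C])
    show "t0 < T1" "T1 < T" "0 \<le> M" by fact+
    show "X t0 = x0" "W t0 = u0" by (simp_all add: X_def W_def \<sigma>_def at_0)
    show "C-lipschitz_on {t0..T1} X"
    proof (rule lipschitz_onI)
      show "dist (X \<tau>) (X \<tau>') \<le> C * dist \<tau> \<tau>'" if "\<tau> \<in> {t0..T1}" "\<tau>' \<in> {t0..T1}" for \<tau> \<tau>'
        using X_lip[of \<tau> \<tau>'] X_lip[of \<tau>' \<tau>] that
        by (cases "\<tau> \<le> \<tau>'") (auto simp: dist_norm norm_minus_commute)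
    qed fact
    show "U \<tau> (X \<tau>) \<le> ereal (W \<tau>)" if "\<tau> \<in> {t0..T1}" for \<tau>
      using Z(3)[of "\<sigma> \<tau>"] \<sigma>[OF that] by (simp add: Z_eq K_def X_def W_def)
    show "ereal (- M) \<le> L \<tau> (X \<tau>) v" if "\<tau> \<in> {t0..T1}" for \<tau> v
    proof (rule M(2))
      show "\<tau> \<in> {0..T}" using Z(3)[of "\<sigma> \<tau>"] \<sigma>[OF that] K_time by (simp add: Z_eq)
      have "dist (X \<tau>) x0 \<le> \<rho>" using near(2)[of "\<sigma> \<tau>"] \<sigma>[OF that] by (simp add: X_def)
      then show "norm (X \<tau>) \<le> R"
        using norm_triangle_sub[of "X \<tau>" x0] \<rho> by (simp add: R_def dist_norm)
    qed
    show "W \<tau> - W \<tau>' \<le> M * (\<tau> - \<tau>')" if "\<tau>' \<in> {t0..T1}" "\<tau> \<in> {t0..T1}" "\<tau>' \<le> \<tau>" for \<tau> \<tau>'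
      using u_le[of "\<sigma> \<tau>'" "\<sigma> \<tau>"] \<sigma>_mono[OF that] \<sigma>[OF that(1)] \<sigma>[OF that(2)] by (simp add: W_def)
    show "\<exists>\<delta>>0. \<forall>\<tau>'\<in>{t0..\<tau>}. \<tau> - \<tau>' < \<delta> \<longrightarrow> inner p (X \<tau> - X \<tau>') + (W \<tau> - W \<tau>') \<le> c * (\<tau> - \<tau>')"
      if \<tau>: "\<tau> \<in> {t0..T1}" and r: "0 < r"
        and minorant: "\<And>t' x v. t' \<in> {0..T} \<Longrightarrow> dist t' \<tau> < r \<Longrightarrow> dist x (X \<tau>) < r \<Longrightarrow> ereal (inner p v - c) \<le> L t' x v"
      for \<tau> p c r
    \<comment> \<open>With this \<delta> the elapsed time and the motion of \<open>X\<close> are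
      both below \<open>r / 2\<close>; two errors below \<open>r / 4\<close>, from the curve to
      \<open>y\<close> and from \<open>y\<close> to \<open>(t', x')\<close>, complete the radius
      \<open>r\<close>.\<close>
    proof (intro exI[of _ "r / (2 * (C + 1))"] conjI ballI impI)
      show "0 < r / (2 * (C + 1))" using r C by simp
      fix \<tau>' assume \<tau>': "\<tau>' \<in> {t0..\<tau>}" "\<tau> - \<tau>' < r / (2 * (C + 1))"
      then have \<tau>'1: "\<tau>' \<in> {t0..T1}" using \<tau> by auto
      have C1: "(C + 1) * (\<tau> - \<tau>') < r / 2" using \<tau>'(2) C by (simp add: field_simps)
      have "0 \<le> C * (\<tau> - \<tau>')" "0 \<le> \<tau> - \<tau>'" using C \<tau>' by auto
      with C1 have small: "\<tau> - \<tau>' < r / 2" "C * (\<tau> - \<tau>') < r / 2" by (simp_all add: algebra_simps)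
      have s12: "0 \<le> \<sigma> \<tau>'" "\<sigma> \<tau>' \<le> \<sigma> \<tau>" "\<sigma> \<tau> \<le> S"
        using \<sigma> \<sigma>_mono \<tau> \<tau>'1 \<tau>'(1) by auto
      have "- c * (t (\<sigma> \<tau>) - t (\<sigma> \<tau>')) + inner p (x (\<sigma> \<tau>) - x (\<sigma> \<tau>')) + 1 * (u (\<sigma> \<tau>) - u (\<sigma> \<tau>'))
          \<le> 0 * (\<sigma> \<tau> - \<sigma> \<tau>')"
      proof (rule lin[OF s12, of "r / 4"])
        show "0 < r / 4" using r by simp
        fix s y t' x' v l
        assume s: "s \<in> {\<sigma> \<tau>'..\<sigma> \<tau>}" and y: "dist y (Z s) < r / 4" and t': "t' \<in> {0..T}"
          and d: "dist t' (fst y) < r / 4" "dist x' (fst (snd y)) < r / 4" and l: "L t' x' v = ereal l"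
        have ts: "\<tau>' \<le> t s" "t s \<le> \<tau>"
          using t_mono[of "\<sigma> \<tau>'" s] t_mono[of s "\<sigma> \<tau>"] s s12 \<sigma>(3)[OF \<tau>] \<sigma>(3)[OF \<tau>'1] by auto
        have "norm (X \<tau> - x s) \<le> C * (\<tau> - t s)"
          using x_lip[of s "\<sigma> \<tau>"] s s12 \<sigma>(3)[OF \<tau>] by (simp add: X_def)
        also have "\<dots> \<le> C * (\<tau> - \<tau>')" using ts C by (intro mult_left_mono) auto
        finally have xs: "dist (x s) (X \<tau>) < r / 2" using small by (simp add: dist_norm norm_minus_commute)
        have ty: "dist (fst y) (t s) < r / 4" using dist_fst_le[of y "Z s"] y by (simp add: Z_eq)
        have xy: "dist (fst (snd y)) (x s) < r / 4"
          using dist_snd_le[of y "Z s"] dist_fst_le[of "snd y" "snd (Z s)"] y by (simp add: Z_eq)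
        have "dist (t s) \<tau> < r / 2" using ts small(1) by (simp add: dist_real_def)
        then have "dist t' \<tau> < r"
          using d(1) ty dist_triangle[of t' \<tau> "t s"] dist_triangle[of t' "t s" "fst y"] by linarith
        moreover have "dist x' (X \<tau>) < r"
          using d(2) xy xs dist_triangle[of x' "X \<tau>" "x s"] dist_triangle[of x' "x s" "fst (snd y)"] by linarith
        ultimately have "ereal (inner p v - c) \<le> L t' x' v" by (intro minorant t')
        then show "- c + inner p v - 1 * l \<le> 0 * (1 + \<bar>l\<bar>)" by (simp add: l)
      qed
      then show "inner p (X \<tau> - X \<tau>') + (W \<tau> - W \<tau>') \<le> c * (\<tau> - \<tau>')"
        using \<sigma>(3)[OF \<tau>] \<sigma>(3)[OF \<tau>'1] by (simp add: X_def W_def)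
    qed
  qed
qed

section \<open>From the curve parametrised by time to a solution of the differential
  inclusion\<close>

lemma backward_quotient_tendsto:
  fixes X :: "real \<Rightarrow> 'a::real_inner"
  assumes X: "(X has_vector_derivative xd) (at t within {a..b})" and t: "a < t" "t \<le> b"
  shows "(\<lambda>n. real (Suc n) * inner p (X t - X (t - 1 / real (Suc n)))) \<longlonglongrightarrow> inner p xd"
proof -
  have "((\<lambda>y. inner p (X y)) has_real_derivative inner p xd) (at t within {a..b})"
    using bounded_linear.has_vector_derivative[OF bounded_linear_inner_right X]
    by (simp add: has_real_derivative_iff_has_vector_derivative)
  then have lim: "((\<lambda>y. (inner p (X y) - inner p (X t)) / (y - t)) \<longlongrightarrow> inner p xd) (at t within {a..b})"
    by (simp add: has_field_derivative_iff)
  have "(\<lambda>n. t - 1 / real (Suc n)) \<longlonglongrightarrow> t - 0"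
    by (intro tendsto_intros) (use LIMSEQ_inverse_real_of_nat in \<open>simp add: inverse_eq_divide\<close>)
  then have seq: "(\<lambda>n. t - 1 / real (Suc n)) \<longlonglongrightarrow> t" by simp
  then have "\<forall>\<^sub>F n in sequentially. a < t - 1 / real (Suc n)"
    by (rule order_tendstoD) (use t in simp)
  then have "\<forall>\<^sub>F n in sequentially. t - 1 / real (Suc n) \<in> {a..b} \<and> t - 1 / real (Suc n) \<noteq> t"
  proof eventually_elim
    case (elim n)
    have "0 < 1 / real (Suc n)" by simp
    with elim t show ?case unfolding atLeastAtMost_iff by linarith
  qed
  with seq have "filterlim (\<lambda>n. t - 1 / real (Suc n)) (at t within {a..b}) sequentially"
    by (simp add: filterlim_at)
  from filterlim_compose[OF lim this]
  have "(\<lambda>n. (inner p (X (t - 1 / real (Suc n))) - inner p (X t)) / (t - 1 / real (Suc n) - t)) \<longlonglongrightarrow> inner p xd" .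
  moreover have "(inner p (X (t - 1 / real (Suc n))) - inner p (X t)) / (t - 1 / real (Suc n) - t)
      = real (Suc n) * inner p (X t - X (t - 1 / real (Suc n)))" for n
    by (simp add: inner_diff_right field_simps del: of_nat_Suc)
  ultimately show ?thesis by simp
qed

theorem theorem4p5:
  fixes T :: real
    and L :: "real \<Rightarrow> 'a::euclidean_space \<Rightarrow> 'a \<Rightarrow> ereal"
    and U :: "real \<Rightarrow> 'a \<Rightarrow> ereal"
  assumes L1: "lsc_on ({0..T} \<times> UNIV \<times> UNIV) (\<lambda>(t, x, v). L t x v)"
    and L2: "\<And>t x. t \<in> {0..T} \<Longrightarrow> econvex (L t x) \<and> proper_on UNIV (L t x)"
    and L3: "\<And>t x v tn xn. t \<in> {0..T} \<Longrightarrow> (\<forall>n. tn n \<in> {0..T}) \<Longrightarrow>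
               tn \<longlonglongrightarrow> t \<Longrightarrow> xn \<longlonglongrightarrow> x \<Longrightarrow>
               \<exists>vn. vn \<longlonglongrightarrow> v \<and> (\<lambda>n. L (tn n) (xn n) (vn n)) \<longlonglongrightarrow> L t x v"
    and L4: "\<And>R. \<exists>C\<ge>0. \<forall>t x v. t \<in> {0..T} \<and> norm x \<le> R \<and> norm v > C \<longrightarrow> L t x v = \<infinity>"
    and U_proper: "proper_on ({0..T} \<times> UNIV) (\<lambda>(t, x). U t x)"
    and U_lsc: "lsc_on ({0..T} \<times> UNIV) (\<lambda>(t, x). U t x)"
    and U_outside: "\<And>t x. t \<notin> {0..T} \<Longrightarrow> U t x = \<infinity>"
    and normal_cond:
      "\<And>t x u nt nx nu.
         ((t, x), u) \<in> epi (\<lambda>(t, x). U t x) \<Longrightarrow> 0 \<le> t \<Longrightarrow> t < T \<Longrightarrow>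
         (nt, nx, nu) \<in> normal_cone {(t', x', u'). ((t', x'), u') \<in> epi (\<lambda>(t, x). U t x)} (t, x, u) \<Longrightarrow>
         \<exists>tk xk \<alpha> vk. (\<forall>k. tk k \<in> {0..T}) \<and> tk \<longlonglongrightarrow> t \<and> xk \<longlonglongrightarrow> x \<and> \<alpha> \<longlonglongrightarrow> 0 \<and>
            (\<forall>k. vk k \<in> edom (L (tk k) (xk k)) \<and>
                 nt + inner (vk k) nx - nu * real_of_ereal (L (tk k) (xk k) (vk k)) \<le> \<alpha> k)"
    and init: "((t0, x0), u0) \<in> epi (\<lambda>(t, x). U t x)" "0 \<le> t0" "t0 < T"
  shows "\<exists>T0 xf uf. t0 < T0 \<and> T0 < T \<and>
           abs_cont_on t0 T0 (\<lambda>t. (xf t, uf t)) \<and>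
           xf t0 = x0 \<and> uf t0 = u0 \<and>
           (\<exists>N. N \<in> null_sets lebesgue \<and>
              (\<forall>t\<in>{t0..T0} - N. \<exists>xd ud.
                  (xf has_vector_derivative xd) (at t within {t0..T0}) \<and>
                  (uf has_real_derivative ud) (at t within {t0..T0}) \<and>
                  (xd, ud) \<in> Qset L t (xf t))) \<and>
           (\<forall>t\<in>{t0..T0}. U t (xf t) \<le> ereal (uf t))"
proof -
  have t0: "t0 \<in> {0..T}" using init by simp
  have "U t0 x0 \<noteq> -\<infinity>" using U_proper t0 unfolding proper_on_def by auto
  moreover have "U t0 x0 \<le> ereal u0" using init(1) by (simp add: epi_def)
  \<comment> \<open>The curve is constructed from the lowest point \<open>w0\<close> over
    \<open>(t0, x0)\<close>; the gap \<open>u0 - w0\<close> is added back in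
    \<open>uf\<close>.\<close>
  ultimately obtain w0 where w0: "U t0 x0 = ereal w0" "w0 \<le> u0"
    by (cases "U t0 x0") auto
  have L_proper: "L t x v \<noteq> -\<infinity>" if "t \<in> {0..T}" for t x v
    using L2[OF that, of x] by (simp add: proper_on_def)
  obtain T1 M X W C where T1: "t0 < T1" "T1 < T" and M: "0 \<le> M" and X0: "X t0 = x0" and W0: "W t0 = w0"
    and X_lip: "C-lipschitz_on {t0..T1} X"
    and viable: "\<And>t. t \<in> {t0..T1} \<Longrightarrow> U t (X t) \<le> ereal (W t)"
    and L_ge: "\<And>t v. t \<in> {t0..T1} \<Longrightarrow> ereal (- M) \<le> L t (X t) v"
    and W_le: "\<And>t t'. t' \<in> {t0..T1} \<Longrightarrow> t \<in> {t0..T1} \<Longrightarrow> t' \<le> t \<Longrightarrow> W t - W t' \<le> M * (t - t')"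
    and minor: "\<And>t p c r. t \<in> {t0..T1} \<Longrightarrow> 0 < r \<Longrightarrow>
       (\<And>t' x v. t' \<in> {0..T} \<Longrightarrow> dist t' t < r \<Longrightarrow> dist x (X t) < r \<Longrightarrow> ereal (inner p v - c) \<le> L t' x v) \<Longrightarrow>
       \<exists>\<delta>>0. \<forall>t'\<in>{t0..t}. t - t' < \<delta> \<longrightarrow> inner p (X t - X t') + (W t - W t') \<le> c * (t - t')"
  proof -
    show thesis
      by (rule reparametrised_trajectory[OF L1 _ L4 U_lsc _ _ w0(1) init(3)])
         (fact L_proper U_outside normal_cond that)+
  qed
  define G where "G t = M * t - W t" for t
  have G: "mono_on {t0..T1} G"
    unfolding mono_on_def G_def using W_le by (auto simp: algebra_simps)
  obtain l where l: "\<And>x. 0 \<le> l x" "l integrable_on {t0..T1}"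
    "\<And>t. t \<in> {t0..T1} \<Longrightarrow> integral {t0..t} l \<le> G t - G t0"
    and l_null: "negligible {x \<in> {t0<..T1}. \<not> (\<forall>y>l x. \<exists>\<^sub>F n in sequentially.
        real (Suc n) * (G x - G (x - 1 / real (Suc n))) < y)}" (is "negligible ?N2")
  proof -
    show thesis by (rule mono_on_lower_derivative[OF G less_imp_le[OF T1(1)]]) (fact that)
  qed
  define F where "F t = integral {t0..t} l" for t
  \<comment> \<open>Here \<open>uf t - W t\<close> equals \<open>u0 - w0\<close> plus
    \<open>G t - G t0 - F t\<close>, and both are nonnegative.\<close>
  define uf where "uf t = u0 + M * (t - t0) - F t" for t
  let ?N1 = "{t \<in> {t0..T1}. \<not> X differentiable (at t within {t0..T1})}"
  let ?N3 = "{t \<in> {t0..T1}. \<not> (F has_vector_derivative l t) (at t within {t0..T1})}"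
  \<comment> \<open>The point \<open>t0\<close> is removed because the backward quotients are
    controlled only on \<open>(t0, T1]\<close>.\<close>
  define N where "N = {t0} \<union> ?N1 \<union> ?N2 \<union> ?N3"
  have "negligible N"
    unfolding N_def F_def using l_null lipschitz_differentiable_AE[OF X_lip]
      indefinite_integral_has_vector_derivative_AE[OF l(2)] by simp
  then have N: "N \<in> null_sets lebesgue" by (simp add: negligible_iff_null_sets)
  have deriv: "\<exists>xd ud. (X has_vector_derivative xd) (at t within {t0..T1}) \<and>
      (uf has_real_derivative ud) (at t within {t0..T1}) \<and> (xd, ud) \<in> Qset L t (X t)"
    if t: "t \<in> {t0..T1} - N" for t
  proof -
    have tt: "t \<in> {t0..T1}" "t0 < t" "t \<le> T1" "t \<in> {0..T}" using t T1 init by (auto simp: N_def)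
    obtain xd where xd: "(X has_vector_derivative xd) (at t within {t0..T1})"
      using t vector_derivative_works by (auto simp: N_def)
    have "(F has_vector_derivative l t) (at t within {t0..T1})" using t by (auto simp: N_def)
    then have "(uf has_real_derivative (M - l t)) (at t within {t0..T1})"
      unfolding uf_def[abs_def]
      by (auto intro!: derivative_eq_intros simp flip: has_real_derivative_iff_has_vector_derivative)
    \<comment> \<open>Since \<open>uf\<close> has derivative \<open>M - l t\<close>, this is
      membership in \<open>Qset\<close>. By duality it is enough to test strict affine minorants of
      \<open>L t (X t)\<close>.\<close>
    moreover have "L t (X t) xd \<le> ereal (l t - M)"
    proof (rule le_of_affine_minorants)
      show "econvex (L t (X t))" using L2[OF tt(4)] by simp
      show "closed (epi (L t (X t)))" by (rule closed_epi_lagrangian[OF L1 tt(4)])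
      show "L t (X t) (SOME v. L t (X t) v \<noteq> \<infinity>) \<noteq> \<infinity>"
        using L2[OF tt(4), of "X t"] by (intro someI_ex[of "\<lambda>v. L t (X t) v \<noteq> \<infinity>"]) (auto simp: proper_on_def)
      show "ereal (- M) \<le> L t (X t) v" for v by (rule L_ge[OF tt(1)])
      fix p c
      assume minorant: "\<And>v. ereal (inner p v - c) < L t (X t) v"
      obtain r where r: "0 < r" "\<And>t' x v. t' \<in> {0..T} \<Longrightarrow> dist t' t < r \<Longrightarrow> dist x (X t) < r \<Longrightarrow>
          ereal (inner p v - c) \<le> L t' x v"
      proof -
        show thesis by (rule affine_minorant_persists[OF L1 L4 tt(4) minorant]) (fact that)
      qed
      from minor[OF tt(1) r] obtain \<delta> where \<delta>: "0 < \<delta>"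
        "\<And>t'. t' \<in> {t0..t} \<Longrightarrow> t - t' < \<delta> \<Longrightarrow> inner p (X t - X t') + (W t - W t') \<le> c * (t - t')"
        by blast
      show "inner p xd - c \<le> l t - M"
      proof (rule ccontr)
        assume "\<not> ?thesis"
        \<comment> \<open>The backward quotients of \<open>G\<close> fall below \<open>y\<close>
          infinitely often by the choice of \<open>l\<close>. The minorant inequality bounds them
          from below by quantities tending to \<open>inner p xd - c + M > y\<close>, a
          contradiction.\<close>
        then obtain y where y: "l t < y" "y < inner p xd - c + M"
          using dense[of "l t" "inner p xd - c + M"] by auto
        have "\<exists>\<^sub>F n in sequentially. real (Suc n) * (G t - G (t - 1 / real (Suc n))) < y"
          using t tt y(1) by (auto simp: N_def)
        moreover have "\<forall>\<^sub>F n in sequentially. y \<le> real (Suc n) * (G t - G (t - 1 / real (Suc n)))"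
        proof -
          have "\<forall>\<^sub>F n in sequentially. y + c - M < real (Suc n) * inner p (X t - X (t - 1 / real (Suc n)))"
            by (rule order_tendstoD(1)[OF backward_quotient_tendsto[OF xd tt(2,3)]]) (use y in simp)
          moreover have "\<forall>\<^sub>F n in sequentially. inverse (real (Suc n)) < min \<delta> (t - t0)"
            by (rule order_tendstoD(2)[OF LIMSEQ_inverse_real_of_nat]) (use \<delta> tt in simp)
          ultimately show ?thesis
          proof eventually_elim
            case (elim n)
            define m where "m = real (Suc n)"
            have m: "0 < m" by (simp add: m_def)
            have "inner p (X t - X (t - 1 / m)) + (W t - W (t - 1 / m)) \<le> c * (t - (t - 1 / m))"
              by (rule \<delta>(2)) (use elim(2) m in \<open>auto simp: m_def inverse_eq_divide\<close>)
            then have "m * (inner p (X t - X (t - 1 / m)) + (W t - W (t - 1 / m))) \<le> m * (c * (1 / m))"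
              using m by (intro mult_left_mono) auto
            then have "m * inner p (X t - X (t - 1 / m)) + m * (W t - W (t - 1 / m)) \<le> c"
              using m by (simp add: distrib_left)
            moreover have "m * (G t - G (t - 1 / m)) = M - m * (W t - W (t - 1 / m))"
              using m by (simp add: G_def field_simps)
            ultimately show ?case using elim(1) unfolding m_def[symmetric] by linarith
          qed
        qed
        ultimately have "\<exists>\<^sub>F n in sequentially. real (Suc n) * (G t - G (t - 1 / real (Suc n))) < y \<and>
            y \<le> real (Suc n) * (G t - G (t - 1 / real (Suc n)))"
          by (rule frequently_eventually_frequently)
        from frequently_ex[OF this] show False by auto
      qed
    qed
    ultimately show ?thesis
      using xd by (intro exI[of _ xd] exI[of _ "M - l t"]) (simp add: Qset_def)
  qed
  have ac: "abs_cont_on t0 T1 (\<lambda>t. (X t, uf t))"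
  proof (rule abs_cont_on_dominated)
    show "abs_cont_on t0 T1 F"
      unfolding F_def by (rule abs_cont_on_indefinite_integral[OF l(2,1)])
    show "0 \<le> C + M" using lipschitz_on_nonneg[OF X_lip] M by simp
    fix c d assume cd: "t0 \<le> c" "c \<le> d" "d \<le> T1"
    have "norm ((X d, uf d) - (X c, uf c)) \<le> norm (X d - X c) + norm (uf d - uf c)"
      using norm_Pair_le[of "X d - X c" "uf d - uf c"] by simp
    also have "norm (X d - X c) \<le> C * (d - c)"
      using lipschitz_onD[OF X_lip, of d c] cd by (simp add: dist_norm)
    also have "norm (uf d - uf c) \<le> M * (d - c) + norm (F d - F c)"
    proof -
      have "uf d - uf c = M * (d - c) - (F d - F c)" by (simp add: uf_def algebra_simps)
      then show ?thesis
        using norm_triangle_ineq4[of "M * (d - c)" "F d - F c"] M cd by (simp add: abs_mult)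
    qed
    finally show "norm ((X d, uf d) - (X c, uf c)) \<le> (C + M) * (d - c) + norm (F d - F c)"
      by (simp add: algebra_simps)
  qed
  have uf_ge: "U t (X t) \<le> ereal (uf t)" if "t \<in> {t0..T1}" for t
  proof -
    have "W t \<le> uf t"
      using l(3)[OF that] w0(2) by (simp add: uf_def F_def G_def W0 algebra_simps)
    with viable[OF that] show ?thesis by (meson ereal_less_eq(3) order_trans)
  qed
  show ?thesis
    using T1 ac X0 N deriv uf_ge
    by (intro exI[of _ T1] exI[of _ X] exI[of _ uf]) (auto simp: uf_def F_def)
qed

end
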